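(* Let $\mathcal{D}$ be a set. The pre-Lie subalgebra $\mathfrak{g}_{\mathcal{D}}$ of $T(V_{\mathcal{D}},f_{\mathcal{D}})$ generated by the biletters $\binom{0}{d}$, $d\in\mathcal{D}$, is freely generated by them, as a pre-Lie algebra.
   Context: $\mathbb{K}$ is a field of characteristic zero. Pre-Lie means right pre-Lie: $(a\bullet b)\bullet c-a\bullet(b\bullet c)=(a\bullet c)\bullet b-a\bullet(c\bullet b)$. For a vector space $V$, $T(V)=\bigoplus_{n\ge 0}V^{\otimes n}$ is spanned by words with letters in $V$; $\emptyset$ is the empty word; juxtaposition is concatenation. The shuffle product $\sqcup\!\sqcup$ is the bilinear product with unit $\emptyset$ and $xu\sqcup\!\sqcup yv=x(u\sqcup\!\sqcup yv)+y(xu\sqcup\!\sqcup v)$. For a linear endomorphism $f$ of $V$, $T(V,f)$ is $T(V)$ with the pre-Lie product defined by $\emptyset\bullet w'=0$ and $(xw)\bullet w'=x(w\bullet w')+f(x)(w\sqcup\!\sqcup w')$ for $x\in V$, $w,w'\in T(V)$. $V_{\mathcal{D}}$ is the vector space with basis the biletters $\binom{k}{d}$, $(k,d)\in\mathbb{N}\times\mathcal{D}$ (with $0\in\mathbb{N}$), and $f_{\mathcal{D}}:V_{\mathcal{D}}\to V_{\mathcal{D}}$ is the linear map with $f_{\mathcal{D}}\binom{k}{d}=\binom{k+1}{d}$. *)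

theory Defs
  imports
    Complex_Main
    "HOL-Library.Poly_Mapping"
    "HOL-Library.FuncSet"
begin

section \<open>Right pre-Lie algebras\<close>

text \<open>
  Algebras are given by a carrier that is a linear subspace of an ambient vector space, so that
  subalgebras and the algebras they live in are instances of the same notion.
\<close>

locale right_pre_lie_algebra = vector_space scale
  for scale :: "'k::field \<Rightarrow> 'a::ab_group_add \<Rightarrow> 'a" +
  fixes A :: "'a set" and mul :: "'a \<Rightarrow> 'a \<Rightarrow> 'a"
  assumes subspace_carrier: "subspace A"
    and mul_closed: "\<lbrakk>x \<in> A; y \<in> A\<rbrakk> \<Longrightarrow> mul x y \<in> A"
    and mul_add_left: "\<lbrakk>x \<in> A; y \<in> A; z \<in> A\<rbrakk> \<Longrightarrow> mul (x + y) z = mul x z + mul y z"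
    and mul_add_right: "\<lbrakk>x \<in> A; y \<in> A; z \<in> A\<rbrakk> \<Longrightarrow> mul x (y + z) = mul x y + mul x z"
    and mul_scale_left: "\<lbrakk>x \<in> A; y \<in> A\<rbrakk> \<Longrightarrow> mul (scale c x) y = scale c (mul x y)"
    and mul_scale_right: "\<lbrakk>x \<in> A; y \<in> A\<rbrakk> \<Longrightarrow> mul x (scale c y) = scale c (mul x y)"
    and right_pre_lie: "\<lbrakk>x \<in> A; y \<in> A; z \<in> A\<rbrakk> \<Longrightarrow>
      mul (mul x y) z - mul x (mul y z) = mul (mul x z) y - mul x (mul z y)"

definition pre_lie_subalgebra ::
    "('k::field \<Rightarrow> 'a::ab_group_add \<Rightarrow> 'a) \<Rightarrow> 'a set \<Rightarrow> ('a \<Rightarrow> 'a \<Rightarrow> 'a) \<Rightarrow> 'a set \<Rightarrow> bool" where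
  "pre_lie_subalgebra scale A mul S \<longleftrightarrow>
     S \<subseteq> A \<and> module.subspace scale S \<and> (\<forall>x\<in>S. \<forall>y\<in>S. mul x y \<in> S)"

definition pre_lie_generated ::
    "('k::field \<Rightarrow> 'a::ab_group_add \<Rightarrow> 'a) \<Rightarrow> 'a set \<Rightarrow> ('a \<Rightarrow> 'a \<Rightarrow> 'a) \<Rightarrow> 'a set \<Rightarrow> 'a set" where
  "pre_lie_generated scale A mul X = pre_lie_subalgebra scale A mul hull X"

definition pre_lie_hom ::
    "('k::field \<Rightarrow> 'a::ab_group_add \<Rightarrow> 'a) \<Rightarrow> 'a set \<Rightarrow> ('a \<Rightarrow> 'a \<Rightarrow> 'a) \<Rightarrow>
     ('k \<Rightarrow> 'b::ab_group_add \<Rightarrow> 'b) \<Rightarrow> 'b set \<Rightarrow> ('b \<Rightarrow> 'b \<Rightarrow> 'b) \<Rightarrow> ('a \<Rightarrow> 'b) \<Rightarrow> bool" where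
  "pre_lie_hom scaleA A mulA scaleB B mulB h \<longleftrightarrow>
     h \<in> A \<rightarrow> B \<and>
     (\<forall>x\<in>A. \<forall>y\<in>A. h (x + y) = h x + h y) \<and>
     (\<forall>c. \<forall>x\<in>A. h (scaleA c x) = scaleB c (h x)) \<and>
     (\<forall>x\<in>A. \<forall>y\<in>A. h (mulA x y) = mulB (h x) (h y))"

text \<open>
  The universal property, against test algebras over the same field whose ambient space is the
  type \<open>'l\<close>. A definition cannot quantify over types, so the type is an argument: freeness is the
  property for every \<open>'l\<close>, which a theorem expresses by leaving \<open>'l\<close> a free type variable.
  Homomorphisms are taken extensional, i.e. equal to \<open>undefined\<close> outside the carrier, so that
  uniqueness is uniqueness on the carrier.
\<close>

definition freely_generated_pre_lie ::
    "'l::ab_group_add itself \<Rightarrow> ('k::field \<Rightarrow> 'a::ab_group_add \<Rightarrow> 'a) \<Rightarrow> 'a set \<Rightarrow>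
     ('a \<Rightarrow> 'a \<Rightarrow> 'a) \<Rightarrow> 'd set \<Rightarrow> ('d \<Rightarrow> 'a) \<Rightarrow> bool" where
  "freely_generated_pre_lie (_ :: 'l itself) scale A mul D g \<longleftrightarrow>
     right_pre_lie_algebra scale A mul \<and> g \<in> D \<rightarrow> A \<and>
     (\<forall>(scaleL :: 'k \<Rightarrow> 'l \<Rightarrow> 'l) L mulL \<phi>.
        right_pre_lie_algebra scaleL L mulL \<and> \<phi> \<in> D \<rightarrow> L \<longrightarrow>
        (\<exists>!h. h \<in> extensional A \<and> pre_lie_hom scale A mul scaleL L mulL h \<and>
              (\<forall>d\<in>D. h (g d) = \<phi> d)))"


section \<open>Vector spaces with a basis\<close>

text \<open>The type \<open>'b \<Rightarrow>\<^sub>0 'k\<close> is the vector space with basis the elements \<open>basis_vec b\<close>.\<close>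

definition pm_scale :: "'k::field \<Rightarrow> ('b \<Rightarrow>\<^sub>0 'k) \<Rightarrow> ('b \<Rightarrow>\<^sub>0 'k)" where
  "pm_scale c p = Poly_Mapping.map (\<lambda>a. c * a) p"

abbreviation basis_vec :: "'b \<Rightarrow> ('b \<Rightarrow>\<^sub>0 'k::field)" where
  "basis_vec b \<equiv> Poly_Mapping.single b 1"

definition lin_ext :: "('a \<Rightarrow> ('b \<Rightarrow>\<^sub>0 'k::field)) \<Rightarrow> ('a \<Rightarrow>\<^sub>0 'k) \<Rightarrow> ('b \<Rightarrow>\<^sub>0 'k)" where
  "lin_ext g p = (\<Sum>a\<in>Poly_Mapping.keys p. pm_scale (Poly_Mapping.lookup p a) (g a))"

definition bilin_ext ::
    "('a \<Rightarrow> 'b \<Rightarrow> ('c \<Rightarrow>\<^sub>0 'k::field)) \<Rightarrow> ('a \<Rightarrow>\<^sub>0 'k) \<Rightarrow> ('b \<Rightarrow>\<^sub>0 'k) \<Rightarrow> ('c \<Rightarrow>\<^sub>0 'k)" where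
  "bilin_ext g p q = lin_ext (\<lambda>a. lin_ext (g a) q) p"

lemma lookup_pm_scale [simp]:
  "Poly_Mapping.lookup (pm_scale c p) a = c * Poly_Mapping.lookup p a"
  by (simp add: pm_scale_def map.rep_eq when_def)

interpretation pm: vector_space pm_scale
  by unfold_locales (auto intro!: poly_mapping_eqI simp: lookup_add algebra_simps)


section \<open>The pre-Lie algebra \<open>T(V, f)\<close>\<close>

text \<open>
  For \<open>V\<close> with basis \<open>X\<close>, the space \<open>T(V)\<close> has as basis the words in \<open>X\<close>, with the empty list as
  the empty word. The operations are defined on words over the basis and extended linearly;
  the equations with arbitrary vectors as letters are proved at the end of this section.
\<close>

definition tensor_space :: "'b set \<Rightarrow> ('b list \<Rightarrow>\<^sub>0 'k::field) set" where
  "tensor_space X = {t. \<forall>w \<in> Poly_Mapping.keys t. set w \<subseteq> X}"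

text \<open>Concatenation of a vector, as a one-letter word, with an element of \<open>T(V)\<close>.\<close>

definition prepend :: "('b \<Rightarrow>\<^sub>0 'k::field) \<Rightarrow> ('b list \<Rightarrow>\<^sub>0 'k) \<Rightarrow> ('b list \<Rightarrow>\<^sub>0 'k)" where
  "prepend = bilin_ext (\<lambda>x w. basis_vec (x # w))"

fun shuffle_words :: "'b list \<Rightarrow> 'b list \<Rightarrow> ('b list \<Rightarrow>\<^sub>0 'k::field)" where
  "shuffle_words [] v = basis_vec v"
| "shuffle_words u [] = basis_vec u"
| "shuffle_words (x # u) (y # v) =
     prepend (basis_vec x) (shuffle_words u (y # v)) +
     prepend (basis_vec y) (shuffle_words (x # u) v)"

definition shuffle_prod ::
    "('b list \<Rightarrow>\<^sub>0 'k::field) \<Rightarrow> ('b list \<Rightarrow>\<^sub>0 'k) \<Rightarrow> ('b list \<Rightarrow>\<^sub>0 'k)" where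
  "shuffle_prod = bilin_ext shuffle_words"

fun bullet_words ::
    "(('b \<Rightarrow>\<^sub>0 'k::field) \<Rightarrow> ('b \<Rightarrow>\<^sub>0 'k)) \<Rightarrow> 'b list \<Rightarrow> 'b list \<Rightarrow> ('b list \<Rightarrow>\<^sub>0 'k)" where
  "bullet_words f [] w' = 0"
| "bullet_words f (x # w) w' =
     prepend (basis_vec x) (bullet_words f w w') +
     prepend (f (basis_vec x)) (shuffle_words w w')"

definition bullet ::
    "(('b \<Rightarrow>\<^sub>0 'k::field) \<Rightarrow> ('b \<Rightarrow>\<^sub>0 'k)) \<Rightarrow>
     ('b list \<Rightarrow>\<^sub>0 'k) \<Rightarrow> ('b list \<Rightarrow>\<^sub>0 'k) \<Rightarrow> ('b list \<Rightarrow>\<^sub>0 'k)" where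
  "bullet f = bilin_ext (bullet_words f)"

lemma lin_ext_superset:
  assumes "finite S" "Poly_Mapping.keys p \<subseteq> S"
  shows "lin_ext g p = (\<Sum>a\<in>S. pm_scale (Poly_Mapping.lookup p a) (g a))"
  unfolding lin_ext_def using assms
  by (intro sum.mono_neutral_left) (auto simp: in_keys_iff)

lemma lin_ext_basis [simp]: "lin_ext g (basis_vec a) = g a"
  by (simp add: lin_ext_def)

lemma lin_ext_0 [simp]: "lin_ext g 0 = 0"
  by (simp add: lin_ext_def)

lemma lin_ext_add: "lin_ext g (p + q) = lin_ext g p + lin_ext g q"
proof -
  let ?S = "Poly_Mapping.keys p \<union> Poly_Mapping.keys q"
  have "Poly_Mapping.keys (p + q) \<subseteq> ?S" by (rule Poly_Mapping.keys_add)
  then show ?thesis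
    by (simp add: lin_ext_superset[of ?S] lookup_add pm.scale_left_distrib sum.distrib)
qed

lemma lin_ext_scale: "lin_ext g (pm_scale c p) = pm_scale c (lin_ext g p)"
proof -
  have "Poly_Mapping.keys (pm_scale c p) \<subseteq> Poly_Mapping.keys p" by (auto simp: in_keys_iff)
  then show ?thesis
    by (simp add: lin_ext_superset[of "Poly_Mapping.keys p"] pm.scale_sum_right)
qed

lemma lin_ext_add_fun: "lin_ext (\<lambda>a. g a + h a) p = lin_ext g p + lin_ext h p"
  by (simp add: lin_ext_def pm.scale_right_distrib sum.distrib)

lemma lin_ext_scale_fun: "lin_ext (\<lambda>a. pm_scale c (g a)) p = pm_scale c (lin_ext g p)"
  by (simp add: lin_ext_def pm.scale_sum_right mult.commute)

lemma lin_ext_0_fun [simp]: "lin_ext (\<lambda>a. 0) p = 0"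
  by (simp add: lin_ext_def)

lemma bilin_ext_basis [simp]: "bilin_ext g (basis_vec a) (basis_vec b) = g a b"
  by (simp add: bilin_ext_def)

lemma bilin_ext_linear:
  "bilin_ext g 0 q = 0" "bilin_ext g p 0 = 0"
  "bilin_ext g (p + p') q = bilin_ext g p q + bilin_ext g p' q"
  "bilin_ext g p (q + q') = bilin_ext g p q + bilin_ext g p q'"
  "bilin_ext g (pm_scale c p) q = pm_scale c (bilin_ext g p q)"
  "bilin_ext g p (pm_scale c q) = pm_scale c (bilin_ext g p q)"
  by (simp_all add: bilin_ext_def lin_ext_add lin_ext_scale lin_ext_add_fun lin_ext_scale_fun)

lemmas tensor_ops_linear =
  bilin_ext_linear[of "\<lambda>x w. basis_vec (x # w)", folded prepend_def]
  bilin_ext_linear[of shuffle_words, folded shuffle_prod_def]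
  bilin_ext_linear[of "bullet_words f" for f, folded bullet_def]

lemma tensor_ops_basis [simp]:
  "prepend (basis_vec x) (basis_vec w) = basis_vec (x # w)"
  "shuffle_prod (basis_vec u) (basis_vec v) = shuffle_words u v"
  "bullet f (basis_vec u) (basis_vec v) = bullet_words f u v"
  by (simp_all add: prepend_def shuffle_prod_def bullet_def)

lemma pm_linear_induct [case_names zero basis add scale]:
  assumes "P 0" "\<And>a. P (basis_vec a)" "\<And>p q. P p \<Longrightarrow> P q \<Longrightarrow> P (p + q)"
    and "\<And>c p. P p \<Longrightarrow> P (pm_scale c p)"
  shows "P (p :: 'b \<Rightarrow>\<^sub>0 'k::field)"
proof -
  have s: "P (\<Sum>a\<in>S. pm_scale (Poly_Mapping.lookup p a) (basis_vec a))" if "finite S" for S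
    using that by (induction S) (auto intro: assms)
  have "p = lin_ext basis_vec p"
  proof (rule poly_mapping_eqI)
    fix b
    have "Poly_Mapping.lookup (lin_ext basis_vec p) b =
        (\<Sum>a\<in>Poly_Mapping.keys p. if a = b then Poly_Mapping.lookup p a else 0)"
      unfolding lin_ext_def lookup_sum
      by (intro sum.cong) (auto simp: lookup_single when_def)
    then show "Poly_Mapping.lookup p b = Poly_Mapping.lookup (lin_ext basis_vec p) b"
      by (simp add: in_keys_iff)
  qed
  then show ?thesis using s[OF finite_keys[of p]] by (simp add: lin_ext_def)
qed

lemma shuffle_prod_Nil:
  "shuffle_prod (basis_vec []) t = t" "shuffle_prod t (basis_vec []) = t"
proof -
  show "shuffle_prod (basis_vec []) t = t"
    by (induction t rule: pm_linear_induct) (simp_all add: tensor_ops_linear)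
  have "shuffle_words u [] = (basis_vec u :: 'a list \<Rightarrow>\<^sub>0 'b)" for u :: "'a list"
    by (cases u) simp_all
  then show "shuffle_prod t (basis_vec []) = t"
    by (induction t rule: pm_linear_induct) (simp_all add: tensor_ops_linear)
qed

lemma shuffle_prod_prepend:
  "shuffle_prod (prepend x u) (prepend y v) =
     prepend x (shuffle_prod u (prepend y v)) + prepend y (shuffle_prod (prepend x u) v)"
proof (induction x rule: pm_linear_induct)
  case (basis x)
  show ?case
  proof (induction u rule: pm_linear_induct)
    case (basis u)
    show ?case
    proof (induction y rule: pm_linear_induct)
      case (basis y)
      show ?case
        by (induction v rule: pm_linear_induct)
          (simp_all add: tensor_ops_linear pm.scale_right_distrib algebra_simps)
    qed (simp_all add: tensor_ops_linear pm.scale_right_distrib algebra_simps)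
  qed (simp_all add: tensor_ops_linear pm.scale_right_distrib algebra_simps)
qed (simp_all add: tensor_ops_linear pm.scale_right_distrib algebra_simps)

lemma bullet_Nil: "bullet f (basis_vec []) t = 0"
  by (induction t rule: pm_linear_induct) (simp_all add: tensor_ops_linear)

lemma bullet_prepend:
  assumes "Vector_Spaces.linear pm_scale pm_scale f"
  shows "bullet f (prepend x w) t = prepend x (bullet f w t) + prepend (f x) (shuffle_prod w t)"
proof -
  interpret f: Vector_Spaces.linear pm_scale pm_scale f by fact
  show ?thesis
  proof (induction x rule: pm_linear_induct)
    case (basis x)
    show ?case
    proof (induction w rule: pm_linear_induct)
      case (basis w)
      show ?case
        by (induction t rule: pm_linear_induct)
          (simp_all add: tensor_ops_linear pm.scale_right_distrib algebra_simps)
    qed (simp_all add: tensor_ops_linear pm.scale_right_distrib algebra_simps)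
  qed (simp_all add: tensor_ops_linear f.add f.scale pm.scale_right_distrib algebra_simps)
qed


section \<open>The pre-Lie algebra \<open>T(V\<^sub>D, f\<^sub>D)\<close> and its subalgebra \<open>g\<^sub>D\<close>\<close>

text \<open>The biletter with upper entry \<open>k\<close> and lower entry \<open>d\<close> is the pair \<open>(k, d)\<close>.\<close>

abbreviation biletters :: "'d set \<Rightarrow> (nat \<times> 'd) set" where
  "biletters D \<equiv> UNIV \<times> D"

definition f_shift :: "(nat \<times> 'd \<Rightarrow>\<^sub>0 'k::field) \<Rightarrow> (nat \<times> 'd \<Rightarrow>\<^sub>0 'k)" where
  "f_shift = lin_ext (\<lambda>(k, d). basis_vec (k + 1, d))"

definition generator :: "'d \<Rightarrow> ((nat \<times> 'd) list \<Rightarrow>\<^sub>0 'k::field)" where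
  "generator d = basis_vec [(0, d)]"

definition g_alg :: "'d set \<Rightarrow> ((nat \<times> 'd) list \<Rightarrow>\<^sub>0 'k::field) set" where
  "g_alg D = pre_lie_generated pm_scale (tensor_space (biletters D)) (bullet f_shift) (generator ` D)"

lemma linear_f_shift: "Vector_Spaces.linear pm_scale pm_scale f_shift"
  by unfold_locales (simp_all add: f_shift_def lin_ext_add lin_ext_scale)

end

theory Submission
  imports Defs "HOL-Library.Multiset" "HOL-Library.Product_Plus"
begin

text \<open>
  In any right pre-Lie algebra \<open>P\<close> with chosen elements \<open>g d\<close>, a rooted tree \<open>t\<close> with root label \<open>d\<close>
  and subtrees \<open>l\<^sub>1, \<dots>, l\<^sub>n\<close> below the root has the value
  \<open>N t = (\<dots>((g d \<bullet> N l\<^sub>1) \<bullet> N l\<^sub>2)\<dots>) \<bullet> N l\<^sub>n\<close>, for some fixed order of the subtrees. The right pre-Lie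
  identity \<open>(x \<bullet> l) \<bullet> m - (x \<bullet> m) \<bullet> l = x \<bullet> (l \<bullet> m) - x \<bullet> (m \<bullet> l)\<close> reorders the factors up to terms
  with fewer factors, as in the spanning half of the Poincare-Birkhoff-Witt theorem, so that the
  values of the trees span the subalgebra generated by the \<open>g d\<close>
  (\<open>pre_lie_generated_subset_span\<close>).

  Hence it suffices that the values in \<open>T(V\<^sub>D, f\<^sub>D)\<close> are linearly independent. Indeed, given
  \<open>\<phi> : D \<rightarrow> L\<close>, take for \<open>P\<close> the product \<open>T(V\<^sub>D, f\<^sub>D) \<times> L\<close> and \<open>g d = (generator d, \<phi> d)\<close>. The first
  projection maps the values in the product to linearly independent elements, so it is injective on
  the subalgebra that they span, and this subalgebra is the graph of the required homomorphism
  (\<open>ex_pre_lie_hom_words\<close>). Uniqueness holds because a homomorphism is determined by its values on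
  generators.

  More is true: the values of the trees are algebraically independent for the shuffle product
  (\<open>lin_ext_forest_eval_eq_0\<close>), and the stronger claim is the one amenable to induction. Removal of a
  first letter \<open>(k, d)\<close> is a derivation of the shuffle product. It maps \<open>N t\<close> to zero if \<open>d\<close> is
  not the label of the root of \<open>t\<close> or if \<open>k\<close> exceeds the number \<open>n\<close> of subtrees below the root, to
  \<open>N l\<^sub>1 \<squnion> \<dots> \<squnion> N l\<^sub>n\<close> if \<open>d\<close> is the label of the root and \<open>k = n\<close>, and in general to a combination of
  shuffle products of \<open>k\<close> trees with one vertex less in total. A polynomial relation between the
  trees is therefore annihilated, by induction on the number of vertices, by formal derivations with
  these properties; and a polynomial in the trees that all of these annihilate is constant
  (\<open>formal_deriv_kernel\<close>), which uses characteristic zero.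
\<close>

section \<open>The shuffle product and the pre-Lie identity on words\<close>

lemma shuffle_words_Nil2 [simp]: "shuffle_words u [] = basis_vec u"
  by (cases u) simp_all

lemma shuffle_words_commute: "shuffle_words u v = shuffle_words v u"
  by (induction u v rule: shuffle_words.induct) (simp_all add: add.commute)

lemma shuffle_prod_commute: "shuffle_prod p q = shuffle_prod q p"
proof (induction p rule: pm_linear_induct)
  case (basis u)
  show ?case
    by (induction q rule: pm_linear_induct)
      (simp_all add: tensor_ops_linear shuffle_words_commute)
qed (simp_all add: tensor_ops_linear)

lemma prepend_diff: "prepend p (q - r) = prepend p q - prepend p r"
  by (metis tensor_ops_linear(4) add_diff_cancel_right' diff_add_cancel)

lemma basis_vec_Cons: "basis_vec (x # w) = prepend (basis_vec x) (basis_vec w)"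
  by simp

lemma shuffle_words_assoc:
  fixes u v w :: "'b list"
  shows "shuffle_prod (shuffle_words u v) (basis_vec w) =
    (shuffle_prod (basis_vec u) (shuffle_words v w) :: 'b list \<Rightarrow>\<^sub>0 'k::field)"
proof (induction "length u + length v + length w" arbitrary: u v w rule: less_induct)
  case less
  let ?sh = "shuffle_prod :: ('b list \<Rightarrow>\<^sub>0 'k) \<Rightarrow> _"
  show ?case
  proof (cases "u = [] \<or> v = [] \<or> w = []")
    case True
    then show ?thesis by (auto simp: shuffle_prod_Nil)
  next
    case False
    then obtain x u' y v' z w' where uvw: "u = x # u'" "v = y # v'" "w = z # w'"
      by (metis neq_Nil_conv)
    have 1: "?sh (shuffle_words u' v) (basis_vec w) =
          ?sh (basis_vec u') (shuffle_words v w)"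
      by (rule less) (simp add: uvw)
    have 2: "?sh (shuffle_words u v') (basis_vec w) =
          ?sh (basis_vec u) (shuffle_words v' w)"
      by (rule less) (simp add: uvw)
    have 3: "?sh (shuffle_words u v) (basis_vec w') =
          ?sh (basis_vec u) (shuffle_words v w')"
      by (rule less) (simp add: uvw)
    have L: "?sh (shuffle_words u v) (basis_vec w) =
        prepend (basis_vec x) (?sh (shuffle_words u' v) (basis_vec w)) +
        prepend (basis_vec y) (?sh (shuffle_words u v') (basis_vec w)) +
        prepend (basis_vec z) (?sh (shuffle_words u v) (basis_vec w'))"
      unfolding uvw basis_vec_Cons[of z]
      by (simp add: tensor_ops_linear shuffle_prod_prepend del: tensor_ops_basis(1))
    have R: "?sh (basis_vec u) (shuffle_words v w) =
        prepend (basis_vec x) (?sh (basis_vec u') (shuffle_words v w)) +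
        prepend (basis_vec y) (?sh (basis_vec u) (shuffle_words v' w)) +
        prepend (basis_vec z) (?sh (basis_vec u) (shuffle_words v w'))"
      unfolding uvw basis_vec_Cons[of x]
      by (simp add: tensor_ops_linear shuffle_prod_prepend del: tensor_ops_basis(1))
    show ?thesis unfolding L R 1 2 3 ..
  qed
qed

lemma shuffle_prod_assoc:
  "shuffle_prod (shuffle_prod p q) r = shuffle_prod p (shuffle_prod q r)"
proof (induction p rule: pm_linear_induct)
  case (basis u)
  show ?case
  proof (induction q rule: pm_linear_induct)
    case (basis v)
    show ?case
      by (induction r rule: pm_linear_induct) (simp_all add: tensor_ops_linear shuffle_words_assoc)
  qed (simp_all add: tensor_ops_linear)
qed (simp_all add: tensor_ops_linear)

interpretation shuffle: comm_monoid_mset shuffle_prod "basis_vec []"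
  by unfold_locales (rule shuffle_prod_assoc shuffle_prod_commute shuffle_prod_Nil)+

lemmas shuffle_prod_ac = shuffle.assoc shuffle.commute shuffle.left_commute

context
  fixes f :: "('b \<Rightarrow>\<^sub>0 'k::field) \<Rightarrow> ('b \<Rightarrow>\<^sub>0 'k)"
  assumes linear_f: "Vector_Spaces.linear pm_scale pm_scale f"
begin

text \<open>
  Both sides satisfy the same recursion on the first letters: \<open>bullet f\<close> acts on one letter of a word
  at a time and leaves the letters before it in place, so that it is a derivation of the shuffle
  product in its left argument.
\<close>

lemma bullet_shuffle_words:
  "bullet f (shuffle_words u v) p =
     shuffle_prod (bullet f (basis_vec u) p) (basis_vec v) +
     shuffle_prod (basis_vec u) (bullet f (basis_vec v) p)"
proof (induction u v rule: shuffle_words.induct)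
  case (1 v)
  then show ?case by (simp add: bullet_Nil shuffle_prod_Nil tensor_ops_linear)
next
  case (2 x u)
  then show ?case by (simp add: bullet_Nil shuffle_prod_Nil tensor_ops_linear)
next
  case (3 x u y v)
  have 0: "shuffle_words u (y # v) = shuffle_prod (basis_vec u) (prepend (basis_vec y) (basis_vec v))"
    "shuffle_words (x # u) v = shuffle_prod (prepend (basis_vec x) (basis_vec u)) (basis_vec v)"
    by simp_all
  show ?case
    using 3 unfolding shuffle_words.simps basis_vec_Cons
    by (simp add: tensor_ops_linear bullet_prepend[OF linear_f] shuffle_prod_prepend 0
         shuffle_prod_ac algebra_simps del: tensor_ops_basis(1))
qed

lemma bullet_shuffle_prod:
  "bullet f (shuffle_prod p q) r = shuffle_prod (bullet f p r) q + shuffle_prod p (bullet f q r)"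
proof (induction p rule: pm_linear_induct)
  case (basis u)
  show ?case
  proof (induction q rule: pm_linear_induct)
    case (basis v)
    show ?case by (simp add: bullet_shuffle_words)
  qed (simp_all add: tensor_ops_linear pm.scale_right_distrib)
qed (simp_all add: tensor_ops_linear pm.scale_right_distrib)

text \<open>
  The associator of \<open>x w\<close>, \<open>q\<close>, \<open>r\<close> is \<open>x\<close> followed by the associator of \<open>w\<close>, \<open>q\<close>, \<open>r\<close>, plus a term
  beginning with \<open>f x\<close> and one beginning with \<open>f (f x)\<close>. By the derivation property, the last two are
  symmetric in \<open>q\<close> and \<open>r\<close>.
\<close>

lemma bullet_associator:
  "bullet f (bullet f p q) r - bullet f p (bullet f q r) =
   bullet f (bullet f p r) q - bullet f p (bullet f r q)"
proof (induction p rule: pm_linear_induct)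
  case (basis w)
  show ?case
  proof (induction w)
    case Nil
    then show ?case by (simp add: bullet_Nil tensor_ops_linear)
  next
    case (Cons x w)
    have "bullet f (bullet f (basis_vec (x # w)) q) r - bullet f (basis_vec (x # w)) (bullet f q r) =
      prepend (basis_vec x)
        (bullet f (bullet f (basis_vec w) q) r - bullet f (basis_vec w) (bullet f q r)) +
      prepend (f (basis_vec x))
        (shuffle_prod (bullet f (basis_vec w) q) r + shuffle_prod (bullet f (basis_vec w) r) q) +
      prepend (f (f (basis_vec x))) (shuffle_prod (shuffle_prod (basis_vec w) q) r)" for q r
      unfolding basis_vec_Cons
      by (simp add: prepend_diff tensor_ops_linear bullet_prepend[OF linear_f] bullet_shuffle_prod
          algebra_simps del: tensor_ops_basis(1))
    with Cons show ?case
      by (simp add: shuffle_prod_ac add.commute add.left_commute)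
  qed
next
  case (scale c p)
  have "pm_scale c (bullet f (bullet f p q) r - bullet f p (bullet f q r)) =
      pm_scale c (bullet f (bullet f p r) q - bullet f p (bullet f r q))"
    by (simp add: scale)
  then show ?case by (simp only: tensor_ops_linear pm.scale_right_diff_distrib)
qed (simp_all add: tensor_ops_linear algebra_simps)

lemma right_pre_lie_algebra_bullet: "right_pre_lie_algebra pm_scale UNIV (bullet f)"
  by unfold_locales (simp_all add: tensor_ops_linear bullet_associator)

end

section \<open>Rooted trees span the generated subalgebra\<close>

text \<open>
  Rooted trees without an order on the subtrees below a vertex, as in the basis of the free
  pre-Lie algebra given by Chapoton and Livernet.
\<close>

datatype 'd rtree = Node (label: 'd) (children: "'d rtree multiset")

primrec nodes :: "'d rtree \<Rightarrow> nat" where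
  "nodes (Node d C) = Suc (sum_mset (image_mset nodes C))"

definition weight :: "'d rtree multiset \<Rightarrow> nat" where
  "weight C = sum_mset (image_mset nodes C)"

lemma weight_simps [simp]:
  "weight {#} = 0" "weight (add_mset t C) = nodes t + weight C" "weight (C + C') = weight C + weight C'"
  by (simp_all add: weight_def)

lemma nodes_Node [simp]: "nodes (Node d C) = Suc (weight C)"
  by (simp add: weight_def)

declare nodes.simps [simp del]

lemma nodes_le_weight: "t \<in># C \<Longrightarrow> nodes t \<le> weight C"
  by (induction C) auto

text \<open>
  An arbitrary order of the elements. It depends on the multiset only, so that the values of a tree in
  different algebras use the same order and correspond to each other under homomorphisms.
\<close>

definition enum_mset :: "'a multiset \<Rightarrow> 'a list" where
  "enum_mset C = (SOME xs. mset xs = C)"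

lemma mset_enum_mset [simp]: "mset (enum_mset C) = C"
  unfolding enum_mset_def by (rule someI_ex) (rule ex_mset)

lemma set_enum_mset [simp]: "set (enum_mset C) = set_mset C"
  by (metis mset_enum_mset set_mset_mset)

function tree_eval :: "('a \<Rightarrow> 'a \<Rightarrow> 'a) \<Rightarrow> ('d \<Rightarrow> 'a) \<Rightarrow> 'd rtree \<Rightarrow> 'a" where
  "tree_eval mul g (Node d C) = foldl mul (g d) (map (tree_eval mul g) (enum_mset C))"
  by pat_completeness auto
termination
  by (relation "Wellfounded.measure (\<lambda>(_, _, t). nodes t)")
    (auto dest: nodes_le_weight)

lemma adjacent_swaps_permute:
  assumes "reflp R" "transp R"
    and swap: "\<And>xs x y ys. R (xs @ x # y # ys) (xs @ y # x # ys)"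
    and "mset xs = mset ys"
  shows "R xs ys"
proof -
  have move: "R (p @ x # as @ bs) (p @ as @ x # bs)" for p x as bs
  proof (induction as arbitrary: p)
    case Nil
    show ?case using \<open>reflp R\<close> by (simp add: reflpD)
  next
    case (Cons a as)
    show ?case
      using transpD[OF \<open>transp R\<close> swap[of p x a "as @ bs"]] Cons[of "p @ [a]"] by simp
  qed
  have "R (p @ xs) (p @ ys)" for p
    using \<open>mset xs = mset ys\<close>
  proof (induction xs arbitrary: p ys)
    case Nil
    then show ?case using \<open>reflp R\<close> by (simp add: reflpD)
  next
    case (Cons x xs)
    then obtain as bs where ys: "ys = as @ x # bs"
      by (metis list.set_intros(1) mset_eq_setD split_list)
    with Cons have "R ((p @ [x]) @ xs) ((p @ [x]) @ as @ bs)"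
      by (intro Cons.IH) simp
    with transpD[OF \<open>transp R\<close> _ move[of p x as bs]] show ?case by (simp add: ys)
  qed
  from this[of "[]"] show ?thesis by simp
qed

context right_pre_lie_algebra
begin

lemma mul_0_left: "y \<in> A \<Longrightarrow> mul 0 y = 0"
  using mul_add_left[of 0 0 y] subspace_0[OF subspace_carrier] by simp

lemma mul_0_right: "y \<in> A \<Longrightarrow> mul y 0 = 0"
  using mul_add_right[of y 0 0] subspace_0[OF subspace_carrier] by simp

lemma mul_diff_left:
  assumes "x \<in> A" "y \<in> A" "z \<in> A"
  shows "mul (x - y) z = mul x z - mul y z"
  using mul_add_left[of "x - y" y z] subspace_diff[OF subspace_carrier] assms
  by (simp add: algebra_simps)

lemma foldl_mul_closed: "x \<in> A \<Longrightarrow> set ys \<subseteq> A \<Longrightarrow> foldl mul x ys \<in> A"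
  by (induction ys arbitrary: x) (auto simp: mul_closed)

lemma foldl_mul_diff:
  "x \<in> A \<Longrightarrow> y \<in> A \<Longrightarrow> set zs \<subseteq> A \<Longrightarrow> foldl mul (x - y) zs = foldl mul x zs - foldl mul y zs"
  by (induction zs arbitrary: x y) (auto simp: mul_closed mul_diff_left)

text \<open>
  Membership of \<open>x\<close> in the carrier is part of the claim because bilinearity holds on the carrier only,
  so that the induction over linear combinations needs it.
\<close>

lemma span_mul_left:
  assumes "x \<in> span X" "X \<subseteq> A" "y \<in> A" "\<And>u. u \<in> X \<Longrightarrow> mul u y \<in> span Y"
  shows "x \<in> A \<and> mul x y \<in> span Y"
  using assms(1)
proof (induction rule: span_induct_alt)
  case base
  show ?case using subspace_0[OF subspace_carrier] assms by (simp add: mul_0_left span_zero)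
next
  case (step c u v)
  then show ?case
    using assms subspace_carrier
    by (auto simp: mul_add_left mul_scale_left subspace_add subspace_scale intro!: span_add span_scale)
qed

lemma span_mul_right:
  assumes "y \<in> span Y" "Y \<subseteq> A" "x \<in> A" "\<And>u. u \<in> Y \<Longrightarrow> mul x u \<in> span Z"
  shows "y \<in> A \<and> mul x y \<in> span Z"
  using assms(1)
proof (induction rule: span_induct_alt)
  case base
  show ?case using subspace_0[OF subspace_carrier] assms by (simp add: mul_0_right span_zero)
next
  case (step c u v)
  then show ?case
    using assms subspace_carrier
    by (auto simp: mul_add_right mul_scale_right subspace_add subspace_scale intro!: span_add span_scale)
qed

lemma span_foldl_mul:
  assumes "x \<in> span X" "X \<subseteq> A" "set zs \<subseteq> A" "\<And>u. u \<in> X \<Longrightarrow> foldl mul u zs \<in> span Y"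
  shows "foldl mul x zs \<in> span Y"
  using assms
proof (induction zs arbitrary: x X)
  case Nil
  have "span X \<subseteq> span Y" by (rule span_minimal) (use Nil in auto)
  with Nil show ?case by auto
next
  case (Cons z zs)
  have "mul x z \<in> span ((\<lambda>u. mul u z) ` X)"
    using span_mul_left[of x X z "(\<lambda>u. mul u z) ` X"] Cons.prems by (auto intro: span_base)
  then have "foldl mul (mul x z) zs \<in> span Y"
    by (rule Cons.IH) (use Cons.prems in \<open>auto simp: mul_closed\<close>)
  then show ?case by simp
qed

context
  fixes g :: "'d \<Rightarrow> 'a"
  assumes g_closed: "\<And>d. g d \<in> A"
begin

lemma tree_eval_closed: "tree_eval mul g t \<in> A"
proof (induction t)
  case (Node d C)
  then show ?case by (auto intro!: foldl_mul_closed g_closed)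
qed

definition tree_span :: "nat \<Rightarrow> 'a set" where
  "tree_span n = span (tree_eval mul g ` {t. nodes t = n})"

lemma tree_eval_in_tree_span: "nodes t = n \<Longrightarrow> tree_eval mul g t \<in> tree_span n"
  unfolding tree_span_def by (auto intro: span_base)

text \<open>
  The straightening step. Exchanging two neighbouring factors \<open>l\<close> and \<open>m\<close> replaces them, by the
  right pre-Lie identity, with the single factor \<open>l \<bullet> m - m \<bullet> l\<close>. This is a combination of trees, as
  the product of two trees with fewer vertices in total than the whole expression; what results
  are expressions with one factor less. The two assumptions are the induction hypotheses for these two
  facts.
\<close>

lemma reorder_factors:
  assumes products: "\<And>t s. nodes t + nodes s < Suc (weight (mset ls)) \<Longrightarrow>
      mul (tree_eval mul g t) (tree_eval mul g s) \<in> tree_span (nodes t + nodes s)"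
    and shorter: "\<And>ls'. length ls' < length ls \<Longrightarrow> weight (mset ls') = weight (mset ls) \<Longrightarrow>
      foldl mul (g d) (map (tree_eval mul g) ls') \<in> tree_span (Suc (weight (mset ls)))"
    and perm: "mset ls = mset ls'"
  shows "foldl mul (g d) (map (tree_eval mul g) ls) - foldl mul (g d) (map (tree_eval mul g) ls')
    \<in> tree_span (Suc (weight (mset ls)))"
proof -
  let ?N = "tree_eval mul g"
  define F where "F xs = foldl mul (g d) (map ?N xs)" for xs
  define S where "S = tree_span (Suc (weight (mset ls)))"
  have S: "subspace S" by (simp add: S_def tree_span_def)
  have swap: "F (xs @ l # m # ys) - F (xs @ m # l # ys) \<in> S"
    if eq: "mset (xs @ l # m # ys) = mset ls" for xs l m ys
  proof -
    define x where "x = F xs"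
    have x: "x \<in> A"
      unfolding x_def F_def by (rule foldl_mul_closed) (auto simp: g_closed tree_eval_closed)
    have Nys: "set (map ?N ys) \<subseteq> A" by (auto simp: tree_eval_closed)
    have wl: "weight (mset xs) + nodes l + nodes m + weight (mset ys) = weight (mset ls)"
      by (simp add: eq[symmetric])
    have len: "length xs + length ys + 2 = length ls"
      using eq by (metis add.commute add_Suc add_Suc_right length_Cons length_append numeral_2_eq_2
          plus_nat.add_0 size_mset add_0_right)
    have ins: "foldl mul (mul x (mul (?N a) (?N b))) (map ?N ys) \<in> S"
      if ab: "nodes a + nodes b = nodes l + nodes m" for a b
    proof -
      let ?U = "{u. nodes u = nodes a + nodes b}"
      have "mul (?N a) (?N b) \<in> span (?N ` ?U)"
        using products[of a b] wl ab by (simp add: tree_span_def)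
      then have img: "mul x (mul (?N a) (?N b)) \<in> span (mul x ` ?N ` ?U)"
        by (rule conjunct2[OF span_mul_right[OF _ _ x]])
          (auto simp: tree_eval_closed intro: span_base)
      have fold: "foldl mul v (map ?N ys) \<in> S" if "v \<in> mul x ` ?N ` ?U" for v
      proof -
        from that obtain u where u: "nodes u = nodes a + nodes b" "v = mul x (?N u)" by auto
        have "F (xs @ u # ys) \<in> S"
          unfolding F_def S_def by (rule shorter) (use wl len u ab in simp_all)
        then show ?thesis by (simp add: F_def x_def u)
      qed
      show ?thesis
        unfolding S_def tree_span_def
        by (rule span_foldl_mul[OF img _ Nys])
          (use x fold in \<open>auto simp: tree_eval_closed mul_closed S_def tree_span_def\<close>)
    qed
    have "F (xs @ l # m # ys) - F (xs @ m # l # ys) =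
        foldl mul (mul (mul x (?N l)) (?N m) - mul (mul x (?N m)) (?N l)) (map ?N ys)"
      using x Nys by (subst foldl_mul_diff) (auto simp: F_def x_def mul_closed tree_eval_closed)
    also have "mul (mul x (?N l)) (?N m) - mul (mul x (?N m)) (?N l) =
        mul x (mul (?N l) (?N m)) - mul x (mul (?N m) (?N l))"
      using right_pre_lie[OF x tree_eval_closed tree_eval_closed, of l m]
      by (simp add: algebra_simps)
    also have "foldl mul \<dots> (map ?N ys) = foldl mul (mul x (mul (?N l) (?N m))) (map ?N ys) -
        foldl mul (mul x (mul (?N m) (?N l))) (map ?N ys)"
      using x Nys by (subst foldl_mul_diff) (auto simp: mul_closed tree_eval_closed)
    also have "\<dots> \<in> S"
      by (rule subspace_diff[OF S]) (auto intro: ins)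
    finally show ?thesis .
  qed
  \<comment> \<open>The relation is restricted to the rearrangements of \<open>ls\<close>, to which the exchange applies.\<close>
  define R where "R xs ys \<longleftrightarrow> (mset xs = mset ls \<longrightarrow> mset ys = mset ls \<and> F xs - F ys \<in> S)" for xs ys
  have "R ls ls'"
  proof (rule adjacent_swaps_permute)
    show "reflp R" by (auto simp: R_def reflp_def subspace_0[OF S])
    show "transp R"
    proof (rule transpI)
      fix xs ys zs assume "R xs ys" "R ys zs"
      then show "R xs zs"
        using subspace_add[OF S, of "F xs - F ys" "F ys - F zs"] by (auto simp: R_def)
    qed
    show "R (xs @ x # y # ys) (xs @ y # x # ys)" for xs x y ys
      using swap by (auto simp: R_def add_mset_commute)
  qed (rule perm)
  then show ?thesis by (simp add: R_def F_def S_def)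
qed

lemma foldl_mul_in_tree_span:
  assumes products: "\<And>t s. nodes t + nodes s < n \<Longrightarrow>
      mul (tree_eval mul g t) (tree_eval mul g s) \<in> tree_span (nodes t + nodes s)"
    and "Suc (weight (mset ls)) = n"
  shows "foldl mul (g d) (map (tree_eval mul g) ls) \<in> tree_span n"
  using assms(2)
proof (induction ls rule: length_induct)
  case (1 ls)
  let ?t = "Node d (mset ls)"
  have "foldl mul (g d) (map (tree_eval mul g) ls) - tree_eval mul g ?t \<in> tree_span n"
    unfolding tree_eval.simps \<open>Suc (weight (mset ls)) = n\<close> [symmetric]
    by (rule reorder_factors) (use products 1 in auto)
  moreover have "tree_eval mul g ?t \<in> tree_span n"
    using 1 by (intro tree_eval_in_tree_span) simp
  ultimately show ?case
    unfolding tree_span_def using span_add by fastforce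
qed

text \<open>
  Right multiplication by a tree \<open>s\<close> adds a factor to the left-normed product that defines the value of
  \<open>t\<close>; only the order of the factors may differ from the chosen one.
\<close>

lemma mul_tree_eval_in_tree_span:
  "mul (tree_eval mul g t) (tree_eval mul g s) \<in> tree_span (nodes t + nodes s)"
proof (induction "nodes t + nodes s" arbitrary: t s rule: less_induct)
  case less
  show ?case
  proof (cases t)
    case (Node d C)
    have "foldl mul (g d) (map (tree_eval mul g) (enum_mset C @ [s])) \<in> tree_span (nodes t + nodes s)"
      by (rule foldl_mul_in_tree_span[OF less]) (simp_all add: Node)
    then show ?thesis by (simp add: Node)
  qed
qed

lemma pre_lie_generated_subset_span:
  "pre_lie_generated scale A mul (range g) \<subseteq> span (range (tree_eval mul g))"
proof -
  let ?N = "tree_eval mul g"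
  have NA: "range ?N \<subseteq> A" by (auto simp: tree_eval_closed)
  have mul_N: "mul (?N t) (?N s) \<in> span (range ?N)" for t s
    using mul_tree_eval_in_tree_span[of t s] span_mono[of "?N ` {u. nodes u = nodes t + nodes s}" "range ?N"]
    by (auto simp: tree_span_def)
  have "mul x y \<in> span (range ?N)" if "x \<in> span (range ?N)" "y \<in> span (range ?N)" for x y
  proof -
    have "mul (?N t) y \<in> span (range ?N)" for t
      using span_mul_right[OF that(2) NA, of "?N t" "range ?N"] mul_N tree_eval_closed by auto
    moreover have "y \<in> A" using that(2) NA span_minimal[OF NA subspace_carrier] by auto
    ultimately show ?thesis
      using span_mul_left[OF that(1) NA, of y "range ?N"] by auto
  qed
  moreover have "g d \<in> span (range ?N)" for d
  proof -
    have "enum_mset {#} = ([] :: 'd rtree list)"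
      using mset_enum_mset[of "{#} :: 'd rtree multiset"] by (simp del: mset_enum_mset)
    then have "?N (Node d {#}) = g d" by simp
    then show ?thesis by (metis rangeI span_base)
  qed
  ultimately show ?thesis
    unfolding pre_lie_generated_def
    by (intro hull_minimal)
      (auto simp: pre_lie_subalgebra_def span_minimal[OF NA subspace_carrier, THEN subsetD])
qed

end
end

section \<open>Derivatives with respect to the first letter of a word\<close>

interpretation words: right_pre_lie_algebra pm_scale UNIV "bullet f_shift"
  by (rule right_pre_lie_algebra_bullet[OF linear_f_shift])

text \<open>
  The partial derivative with respect to the letter \<open>b\<close>; it is a derivation of the shuffle product.
\<close>

definition left_deriv :: "'b \<Rightarrow> ('b list \<Rightarrow>\<^sub>0 'k::field) \<Rightarrow> ('b list \<Rightarrow>\<^sub>0 'k)" where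
  "left_deriv b = lin_ext (\<lambda>w. case w of [] \<Rightarrow> 0 | c # v \<Rightarrow> if c = b then basis_vec v else 0)"

lemma left_deriv_linear:
  "left_deriv b 0 = 0" "left_deriv b (p + q) = left_deriv b p + left_deriv b q"
  "left_deriv b (pm_scale c p) = pm_scale c (left_deriv b p)"
  by (simp_all add: left_deriv_def lin_ext_add lin_ext_scale)

lemma left_deriv_basis:
  "left_deriv b (basis_vec []) = 0" "left_deriv b (basis_vec (c # v)) = (if c = b then basis_vec v else 0)"
  by (simp_all add: left_deriv_def)

lemma left_deriv_prepend: "left_deriv b (prepend (basis_vec c) p) = (if c = b then p else 0)"
  by (induction p rule: pm_linear_induct) (auto simp: tensor_ops_linear left_deriv_linear left_deriv_basis)

lemma left_deriv_shuffle_words: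
  "left_deriv b (shuffle_words u v) =
     shuffle_prod (left_deriv b (basis_vec u)) (basis_vec v) + shuffle_prod (basis_vec u) (left_deriv b (basis_vec v))"
  by (cases u; cases v)
    (auto simp: left_deriv_basis left_deriv_linear left_deriv_prepend shuffle_prod_Nil tensor_ops_linear)

lemma left_deriv_shuffle_prod:
  "left_deriv b (shuffle_prod p q) = shuffle_prod (left_deriv b p) q + shuffle_prod p (left_deriv b q)"
proof (induction p rule: pm_linear_induct)
  case (basis u)
  show ?case
    by (induction q rule: pm_linear_induct)
      (simp_all add: tensor_ops_linear left_deriv_linear left_deriv_shuffle_words pm.scale_right_distrib add_ac)
qed (simp_all add: tensor_ops_linear left_deriv_linear pm.scale_right_distrib add_ac)

lemma f_shift_basis: "f_shift (basis_vec (k, d)) = basis_vec (Suc k, d)"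
  by (simp add: f_shift_def)

text \<open>
  The second term comes from the action of \<open>bullet\<close> on the first letter, which raises the upper entry
  by one and shuffles the rest of the word with \<open>q\<close>; no letter with upper entry zero arises in this way.
\<close>

lemma left_deriv_bullet:
  "left_deriv (k, d) (bullet f_shift p q) =
     bullet f_shift (left_deriv (k, d) p) q +
     (case k of 0 \<Rightarrow> 0 | Suc j \<Rightarrow> shuffle_prod (left_deriv (j, d) p) q)"
proof (induction p rule: pm_linear_induct)
  case (basis w)
  show ?case
  proof (cases w)
    case Nil
    then show ?thesis by (simp add: bullet_Nil left_deriv_basis left_deriv_linear tensor_ops_linear split: nat.split)
  next
    case (Cons x w')
    obtain j e where x: "x = (j, e)" by (cases x)
    show ?thesis
      unfolding Cons basis_vec_Cons
      by (auto simp: bullet_prepend[OF linear_f_shift] f_shift_basis left_deriv_linear left_deriv_prepend x tensor_ops_linear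
          simp del: tensor_ops_basis(1) split: nat.split)
  qed
qed (simp_all add: tensor_ops_linear left_deriv_linear pm.scale_right_distrib add_ac split: nat.split)

abbreviation word_eval :: "'d rtree \<Rightarrow> ((nat \<times> 'd) list \<Rightarrow>\<^sub>0 'k::field)" where
  "word_eval \<equiv> tree_eval (bullet f_shift) generator"

text \<open>
  The monomials in the trees are the forests, with the shuffle product as multiplication.
\<close>

definition forest_eval :: "'d rtree multiset \<Rightarrow> ((nat \<times> 'd) list \<Rightarrow>\<^sub>0 'k::field)" where
  "forest_eval F = shuffle.F (image_mset word_eval F)"

lemma forest_eval_simps [simp]:
  "forest_eval {#} = basis_vec []"
  "forest_eval (add_mset t F) = shuffle_prod (word_eval t) (forest_eval F)"
  "forest_eval (F + G) = shuffle_prod (forest_eval F) (forest_eval G)"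
  by (simp_all add: forest_eval_def)

definition forest_span :: "nat \<Rightarrow> nat \<Rightarrow> ((nat \<times> 'd) list \<Rightarrow>\<^sub>0 'k::field) set" where
  "forest_span k w = pm.span (forest_eval ` {F. size F = k \<and> weight F = w})"

text \<open>
  Additivity and homogeneity are separate assumptions because the maps to which this is applied, such
  as \<open>\<lambda>p. bullet f_shift p q\<close>, come with these equations.
\<close>

lemma linear_image_span:
  fixes h :: "('a \<Rightarrow>\<^sub>0 'k::field) \<Rightarrow> ('b \<Rightarrow>\<^sub>0 'k)"
  assumes add: "\<And>p q. h (p + q) = h p + h q" and scale: "\<And>c p. h (pm_scale c p) = pm_scale c (h p)"
    and "x \<in> pm.span X" "\<And>u. u \<in> X \<Longrightarrow> h u \<in> pm.span Y"
  shows "h x \<in> pm.span Y"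
  using assms(3)
proof (induction rule: pm.span_induct_alt)
  case base
  have "h 0 = 0" using add[of 0 0] by simp
  then show ?case by (simp add: pm.span_zero)
next
  case (step c u v)
  then show ?case by (simp add: add scale assms(4) pm.span_add pm.span_scale)
qed

lemma forest_eval_in_forest_span: "size F = k \<Longrightarrow> weight F = w \<Longrightarrow> forest_eval F \<in> forest_span k w"
  unfolding forest_span_def by (rule pm.span_base) auto

lemma shuffle_tree_span_forest_eval:
  assumes "p \<in> pm.span (word_eval ` {t. nodes t = n})"
  shows "shuffle_prod p (forest_eval F) \<in> forest_span (Suc (size F)) (n + weight F)"
  unfolding forest_span_def
proof (rule linear_image_span[OF _ _ assms])
  fix u assume "u \<in> (word_eval :: 'a rtree \<Rightarrow> (nat \<times> 'a) list \<Rightarrow>\<^sub>0 'b) ` {t. nodes t = n}"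
  then obtain t where t: "u = word_eval t" "nodes t = n" by auto
  have "forest_eval (add_mset t F) \<in> forest_span (Suc (size F)) (n + weight F)"
    by (rule forest_eval_in_forest_span) (simp_all add: t)
  then show "shuffle_prod u (forest_eval F) \<in> pm.span (forest_eval ` {Fa. size Fa = Suc (size F) \<and> weight Fa = n + weight F})"
    by (simp add: t forest_span_def)
qed (simp_all add: tensor_ops_linear)

lemma shuffle_forest_span:
  assumes "p \<in> forest_span k w"
  shows "shuffle_prod (word_eval t) p \<in> forest_span (Suc k) (nodes t + w)"
  unfolding forest_span_def
proof (rule linear_image_span[OF _ _ assms[unfolded forest_span_def]])
  fix u assume "u \<in> (forest_eval :: 'a rtree multiset \<Rightarrow> (nat \<times> 'a) list \<Rightarrow>\<^sub>0 'b) ` {F. size F = k \<and> weight F = w}"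
  then obtain F where F: "u = forest_eval F" "size F = k" "weight F = w" by auto
  show "shuffle_prod (word_eval t) u \<in> pm.span (forest_eval ` {F. size F = Suc k \<and> weight F = nodes t + w})"
    using forest_eval_in_forest_span[of "add_mset t F" "Suc k" "nodes t + w"] F
    by (simp add: forest_span_def)
qed (simp_all add: tensor_ops_linear)

text \<open>
  \<open>bullet\<close> with \<open>word_eval s\<close> acts on a shuffle product of trees as a derivation, hence on one tree at a
  time, and the product of two trees is a combination of trees.
\<close>

lemma bullet_forest_eval:
  "bullet f_shift (forest_eval F) (word_eval s) \<in> forest_span (size F) (weight F + nodes s)"
proof (induction F)
  case empty
  then show ?case by (simp add: bullet_Nil forest_span_def pm.span_zero)
next
  case (add t F)
  have "bullet f_shift (word_eval t) (word_eval s) \<in>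
      pm.span ((word_eval :: 'a rtree \<Rightarrow> (nat \<times> 'a) list \<Rightarrow>\<^sub>0 'b) ` {u. nodes u = nodes t + nodes s})"
    using words.mul_tree_eval_in_tree_span[of generator t s] by (simp add: words.tree_span_def)
  from shuffle_tree_span_forest_eval[OF this, of F] shuffle_forest_span[OF add, of t]
  show ?case
    by (simp add: bullet_shuffle_prod[OF linear_f_shift] forest_span_def pm.span_add add_ac)
qed

lemma bullet_forest_span:
  assumes "p \<in> forest_span k w"
  shows "bullet f_shift p (word_eval s) \<in> forest_span k (w + nodes s)"
  unfolding forest_span_def
  by (rule linear_image_span[OF _ _ assms[unfolded forest_span_def]])
    (use bullet_forest_eval in \<open>auto simp: tensor_ops_linear forest_span_def\<close>)

text \<open>
  Each factor multiplied from the right either is absorbed by the part after the first letter or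
  raises the upper entry \<open>k\<close> of the first letter by one and becomes a new factor of the shuffle product.
  So \<open>k\<close> counts the factors, and it is maximal exactly when none of them is absorbed.
\<close>

lemma left_deriv_word_list:
  fixes ls :: "'d rtree list" and d :: 'd
  defines "w \<equiv> foldl (bullet f_shift) (generator d) (map word_eval ls) :: (nat \<times> 'd) list \<Rightarrow>\<^sub>0 'k::field"
  shows "e \<noteq> d \<or> length ls < k \<Longrightarrow> left_deriv (k, e) w = 0"
    and "left_deriv (length ls, d) w = forest_eval (mset ls)"
    and "left_deriv (k, e) w \<in> forest_span k (weight (mset ls))"
  unfolding w_def
proof (induction ls arbitrary: k e rule: rev_induct)
  case Nil
  { case 1 then show ?case by (auto simp: generator_def left_deriv_basis) }
  { case 2 then show ?case by (auto simp: generator_def left_deriv_basis) }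
  { case 3
    have "basis_vec [] \<in> (forest_span 0 0 :: ((nat \<times> 'd) list \<Rightarrow>\<^sub>0 'k) set)"
      using forest_eval_in_forest_span[of "{#}" 0 0] by simp
    then show ?case by (auto simp: generator_def left_deriv_basis forest_span_def pm.span_zero) }
next
  case (snoc l ls)
  { case 1
    with snoc(1)[of e k] snoc(1)[of e "k - 1"] show ?case
      by (auto simp: left_deriv_bullet tensor_ops_linear split: nat.split) }
  { case 2
    from snoc(1)[of d "Suc (length ls)"] snoc(2) show ?case
      by (simp add: left_deriv_bullet tensor_ops_linear shuffle_prod_commute) }
  { case 3
    show ?case
    proof (cases k)
      case 0
      with bullet_forest_span[OF snoc(3)[of k e], of l] show ?thesis
        by (simp add: left_deriv_bullet add_ac)
    next
      case (Suc j)
      with bullet_forest_span[OF snoc(3)[of k e], of l] shuffle_forest_span[OF snoc(3)[of j e], of l]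
      show ?thesis
        by (simp add: left_deriv_bullet forest_span_def pm.span_add add_ac shuffle_prod_commute)
    qed }
qed

lemma left_deriv_word_eval:
  "e \<noteq> label t \<or> size (children t) < k \<Longrightarrow> left_deriv (k, e) (word_eval t) = 0"
  "left_deriv (size (children t), label t) (word_eval t) = forest_eval (children t)"
  "left_deriv (k, e) (word_eval t) \<in> forest_span k (weight (children t))"
proof -
  obtain d C where t: "t = Node d C" by (cases t)
  have len: "length (enum_mset C) = size C" by (metis mset_enum_mset size_mset)
  show "e \<noteq> label t \<or> size (children t) < k \<Longrightarrow> left_deriv (k, e) (word_eval t) = 0"
    "left_deriv (size (children t), label t) (word_eval t) = forest_eval (children t)"
    "left_deriv (k, e) (word_eval t) \<in> forest_span k (weight (children t))"
    using left_deriv_word_list[where ls = "enum_mset C" and d = d] by (simp_all add: t len)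
qed

section \<open>Algebraic independence of the rooted trees\<close>

lemma lookup_sum_mset:
  "Poly_Mapping.lookup (\<Sum>x\<in>#X. h x) b = (\<Sum>x\<in>#X. Poly_Mapping.lookup (h x) b)"
  by (induction X) (simp_all add: lookup_add)

lemma lookup_lin_ext:
  "Poly_Mapping.lookup (lin_ext h p) b =
    (\<Sum>a\<in>Poly_Mapping.keys p. Poly_Mapping.lookup p a * Poly_Mapping.lookup (h a) b)"
  by (simp add: lin_ext_def lookup_sum)

text \<open>
  Multiplication by the monomial \<open>E\<close> in the polynomial ring whose variables are the elements of the type
  \<open>'t\<close> and whose monomials are the multisets of variables.
\<close>

definition shift_forest :: "'t multiset \<Rightarrow> ('t multiset \<Rightarrow>\<^sub>0 'k::field) \<Rightarrow> ('t multiset \<Rightarrow>\<^sub>0 'k)" where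
  "shift_forest E = lin_ext (\<lambda>G. basis_vec (E + G))"

lemma lookup_shift_forest:
  "Poly_Mapping.lookup (shift_forest E p) H =
    (if E \<subseteq># H then Poly_Mapping.lookup p (H - E) else 0)"
proof (induction p rule: pm_linear_induct)
  case (basis G)
  have "E + G = H \<longleftrightarrow> E \<subseteq># H \<and> G = H - E" by (auto simp: mset_subset_eq_exists_conv)
  then show ?case by (auto simp: shift_forest_def lookup_single when_def)
qed (simp_all add: shift_forest_def lin_ext_add lin_ext_scale lookup_add)

text \<open>
  The derivation of this polynomial ring that maps the variable \<open>t\<close> to the polynomial \<open>a t\<close>.
\<close>

definition formal_deriv ::
    "('t \<Rightarrow> ('t multiset \<Rightarrow>\<^sub>0 'k::field)) \<Rightarrow> ('t multiset \<Rightarrow>\<^sub>0 'k) \<Rightarrow> ('t multiset \<Rightarrow>\<^sub>0 'k)" where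
  "formal_deriv a = lin_ext (\<lambda>F. \<Sum>t\<in>#F. shift_forest (F - {#t#}) (a t))"

lemma lookup_formal_deriv:
  "Poly_Mapping.lookup (formal_deriv a p) H =
    (\<Sum>F\<in>Poly_Mapping.keys p. Poly_Mapping.lookup p F *
      (\<Sum>t\<in>#F. if F - {#t#} \<subseteq># H then Poly_Mapping.lookup (a t) (H - (F - {#t#})) else 0))"
  by (simp add: formal_deriv_def lookup_lin_ext lookup_sum_mset lookup_shift_forest)

lemma keys_formal_deriv:
  assumes "H \<in> Poly_Mapping.keys (formal_deriv a p)"
  obtains E t G where "add_mset t E \<in> Poly_Mapping.keys p" "G \<in> Poly_Mapping.keys (a t)" "H = E + G"
proof -
  from assms obtain F where F: "F \<in> Poly_Mapping.keys p"
    "(\<Sum>t\<in>#F. if F - {#t#} \<subseteq># H then Poly_Mapping.lookup (a t) (H - (F - {#t#})) else 0) \<noteq> 0"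
    by (auto simp: in_keys_iff lookup_formal_deriv elim: sum.not_neutral_contains_not_neutral)
  then obtain t where t: "t \<in># F" "F - {#t#} \<subseteq># H" "Poly_Mapping.lookup (a t) (H - (F - {#t#})) \<noteq> 0"
    using sum_mset.neutral[of "image_mset (\<lambda>t. if F - {#t#} \<subseteq># H
      then Poly_Mapping.lookup (a t) (H - (F - {#t#})) else 0) F"]
    by (auto split: if_splits)
  show ?thesis
    by (rule that[of t "F - {#t#}" "H - (F - {#t#})"]) (use F t in \<open>auto simp: in_keys_iff\<close>)
qed

text \<open>
  Let \<open>m\<close> be the smallest number of vertices of a variable \<open>t\<close> that occurs in \<open>p\<close>. Choose a monomial
  \<open>add_mset t0 E\<close> of \<open>p\<close> where \<open>t0\<close> has \<open>m\<close> vertices and, for this \<open>E\<close>, the largest possible number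
  \<open>n\<close> of subtrees below the root, and let \<open>C\<close> be the forest of these subtrees. In the derivative of
  \<open>p\<close> for \<open>n\<close> and the root label of \<open>t0\<close>, the coefficient of \<open>E + C\<close> comes from the chosen monomial
  only: the trees in \<open>C\<close> have fewer than \<open>m\<close> vertices, so the \<open>n\<close> trees that the derivation introduces
  must be those of \<open>C\<close>, and by maximality of \<open>n\<close> this identifies the variable that it acted on. The
  coefficient is a positive multiple of that of the chosen monomial, hence nonzero in characteristic
  zero.
\<close>

lemma formal_deriv_kernel:
  fixes a :: "nat \<times> 'd \<Rightarrow> 'd rtree \<Rightarrow> ('d rtree multiset \<Rightarrow>\<^sub>0 'k::field_char_0)"
  assumes homogeneous: "\<And>k d t G. G \<in> Poly_Mapping.keys (a (k, d) t) \<Longrightarrow>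
      size G = k \<and> weight G = weight (children t)"
    and low: "\<And>k d t. d \<noteq> label t \<or> size (children t) < k \<Longrightarrow> a (k, d) t = 0"
    and top: "\<And>t. a (size (children t), label t) t = basis_vec (children t)"
    and kernel: "\<And>b. formal_deriv (a b) p = 0"
  shows "Poly_Mapping.keys p \<subseteq> {{#}}"
proof (rule ccontr)
  assume "\<not> Poly_Mapping.keys p \<subseteq> {{#}}"
  then obtain F1 t1 where ft1: "F1 \<in> Poly_Mapping.keys p" "t1 \<in># F1" by auto
  define m where "m = (LEAST m. \<exists>F\<in>Poly_Mapping.keys p. \<exists>t\<in>#F. nodes t = m)"
  have "\<exists>F\<in>Poly_Mapping.keys p. \<exists>t\<in>#F. nodes t = m"
    unfolding m_def by (rule LeastI) (use ft1 in blast)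
  then obtain F2 t2 where F2: "F2 \<in> Poly_Mapping.keys p" "t2 \<in># F2" "nodes t2 = m" by blast
  have min: "m \<le> nodes t" if "F \<in> Poly_Mapping.keys p" "t \<in># F" for F t
    unfolding m_def by (rule Least_le) (use that in blast)
  define E where "E = F2 - {#t2#}"
  let ?T = "{t. nodes t = m \<and> add_mset t E \<in> Poly_Mapping.keys p}"
  have "finite ?T"
  proof (rule finite_subset)
    show "?T \<subseteq> (\<Union>F\<in>Poly_Mapping.keys p. set_mset F)" by auto
  qed simp
  then have fin: "finite ((\<lambda>t. size (children t)) ` ?T)" by (rule finite_imageI)
  have "t2 \<in> ?T" using F2 by (simp add: E_def)
  then have "Max ((\<lambda>t. size (children t)) ` ?T) \<in> (\<lambda>t. size (children t)) ` ?T"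
    by (intro Max_in fin) blast
  then obtain t0 where t0: "t0 \<in> ?T"
    and t0_Max: "Max ((\<lambda>t. size (children t)) ` ?T) = size (children t0)"
    by blast
  have max: "size (children t) \<le> size (children t0)" if "t \<in> ?T" for t
    unfolding t0_Max [symmetric] by (intro Max_ge fin imageI that)
  define C where "C = children t0"
  define F0 where "F0 = add_mset t0 E"
  define b where "b = (size C, label t0)"
  let ?H = "E + C"
  have wC: "Suc (weight C) = m" using t0 by (cases t0) (simp add: C_def)
  have only: "F = F0 \<and> t = t0"
    if F: "F \<in> Poly_Mapping.keys p" "t \<in># F" and sub: "F - {#t#} \<subseteq># ?H"
      and nz: "Poly_Mapping.lookup (a b t) (?H - (F - {#t#})) \<noteq> 0" for F t
  proof -
    define E' where "E' = F - {#t#}"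
    define G where "G = ?H - E'"
    have EG: "E' + G = E + C" using sub by (simp add: G_def E'_def)
    have G: "G \<in> Poly_Mapping.keys (a (size C, label t0) t)"
      using nz by (simp add: in_keys_iff G_def E'_def b_def)
    \<comment> \<open>The factor \<open>E'\<close> is part of a monomial of \<open>p\<close>, so its trees have at least \<open>m\<close> vertices;
      hence the small trees of \<open>C\<close> all come from \<open>G\<close>.\<close>
    have "C \<subseteq># G"
    proof (rule mset_subset_eqI)
      fix s
      show "count C s \<le> count G s"
      proof (cases "s \<in># C")
        case True
        then have "nodes s < m" using nodes_le_weight[OF True] wC by simp
        then have "s \<notin># E'" using min[OF F(1), of s] by (auto simp: E'_def dest: in_diffD)
        then show ?thesis using arg_cong[OF EG, of "\<lambda>X. count X s"] by (simp add: not_in_iff)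
      qed (simp add: not_in_iff)
    qed
    moreover have "size G = size C" using homogeneous[OF G] by simp
    ultimately have GC: "G = C" by (metis mset_subset_size nat_neq_iff subset_mset.le_neq_trans)
    with EG have E': "E' = E" by simp
    then have FE: "F = add_mset t E" using insert_DiffM[OF F(2)] by (simp add: E'_def)
    have "nodes t = m" using homogeneous[OF G] GC wC by (cases t) simp
    then have "size (children t) \<le> size C" using max[of t] F(1) FE by (simp add: C_def)
    moreover have "\<not> (label t0 \<noteq> label t \<or> size (children t) < size C)"
    proof
      assume "label t0 \<noteq> label t \<or> size (children t) < size C"
      with G show False by (simp add: low)
    qed
    ultimately have "size (children t) = size C" "label t = label t0" by auto
    with top[of t] G GC have "children t = C" by (simp split: if_splits)
    then have "t = t0" using \<open>label t = label t0\<close> by (simp add: C_def rtree.expand)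
    with FE show ?thesis by (simp add: F0_def)
  qed
  have F0: "F0 \<in> Poly_Mapping.keys p" using t0 by (simp add: F0_def)
  have single_term: "(if F - {#t#} \<subseteq># ?H then Poly_Mapping.lookup (a b t) (?H - (F - {#t#})) else 0) =
      (if F = F0 \<and> t = t0 then 1 else 0)" if "F \<in> Poly_Mapping.keys p" "t \<in># F" for F t
  proof (cases "F = F0 \<and> t = t0")
    case True
    then show ?thesis using top[of t0] by (simp add: F0_def b_def flip: C_def)
  next
    case False
    with only[OF that] show ?thesis by auto
  qed
  have "0 = Poly_Mapping.lookup (formal_deriv (a b) p) ?H" by (simp add: kernel)
  also have "\<dots> = (\<Sum>F\<in>Poly_Mapping.keys p. Poly_Mapping.lookup p F *
      (\<Sum>t\<in>#F. if F = F0 \<and> t = t0 then 1 else 0))"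
    unfolding lookup_formal_deriv
    by (intro sum.cong refl arg_cong2[where f = "(*)"] arg_cong[where f = sum_mset] image_mset_cong)
      (rule single_term)
  also have "\<dots> = (\<Sum>F\<in>Poly_Mapping.keys p. if F = F0 then Poly_Mapping.lookup p F * of_nat (count F0 t0) else 0)"
    by (intro sum.cong) (auto simp: sum_mset_delta)
  also have "\<dots> = Poly_Mapping.lookup p F0 * of_nat (count F0 t0)"
    using F0 by (simp add: sum.delta)
  finally have "(of_nat (count F0 t0) :: 'k) = 0" using F0 by (simp add: in_keys_iff)
  then show False unfolding of_nat_eq_0_iff by (simp add: F0_def)
qed

lemma lin_ext_forest_eval_shift:
  "lin_ext forest_eval (shift_forest E p) = shuffle_prod (forest_eval E) (lin_ext forest_eval p)"
  by (induction p rule: pm_linear_induct)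
    (simp_all add: shift_forest_def lin_ext_add lin_ext_scale tensor_ops_linear)

lemma left_deriv_forest_eval:
  "left_deriv b (forest_eval F) = (\<Sum>t\<in>#F. shuffle_prod (forest_eval (F - {#t#})) (left_deriv b (word_eval t)))"
proof (induction F)
  case empty
  then show ?case by (simp add: left_deriv_basis)
next
  case (add s F)
  have dist: "shuffle_prod q (\<Sum>t\<in>#X. h t) = (\<Sum>t\<in>#X. shuffle_prod q (h t))"
    for q :: "(nat \<times> 'a) list \<Rightarrow>\<^sub>0 'b" and X :: "'a rtree multiset" and h
    by (induction X) (simp_all add: tensor_ops_linear)
  have "(\<Sum>t\<in>#F. shuffle_prod (forest_eval (add_mset s F - {#t#})) (left_deriv b (word_eval t))) =
      (\<Sum>t\<in>#F. shuffle_prod (word_eval s) (shuffle_prod (forest_eval (F - {#t#})) (left_deriv b (word_eval t)) :: (nat \<times> 'a) list \<Rightarrow>\<^sub>0 'b))"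
  proof (intro arg_cong[where f = sum_mset] image_mset_cong)
    fix t assume "t \<in># F"
    then have "add_mset s F - {#t#} = add_mset s (F - {#t#})"
      by (metis insert_DiffM add_mset_commute add_mset_remove_trivial)
    then show "shuffle_prod (forest_eval (add_mset s F - {#t#})) (left_deriv b (word_eval t)) =
        (shuffle_prod (word_eval s) (shuffle_prod (forest_eval (F - {#t#})) (left_deriv b (word_eval t)))
          :: (nat \<times> 'a) list \<Rightarrow>\<^sub>0 'b)"
      by (simp add: shuffle_prod_assoc)
  qed
  then show ?case
    by (simp add: left_deriv_shuffle_prod add dist shuffle_prod_commute)
qed

lemma lin_ext_forest_eval_formal_deriv:
  assumes a: "\<And>t. lin_ext forest_eval (a t) = left_deriv b (word_eval t)"
  shows "lin_ext forest_eval (formal_deriv a p) = left_deriv b (lin_ext forest_eval p)"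
proof (induction p rule: pm_linear_induct)
  case (basis F)
  have "lin_ext forest_eval (\<Sum>t\<in>#X. h t) = (\<Sum>t\<in>#X. lin_ext forest_eval (h t) :: (nat \<times> 'a) list \<Rightarrow>\<^sub>0 'b)"
    for X :: "'a rtree multiset" and h
    by (induction X) (simp_all add: lin_ext_add)
  then show ?case
    by (simp add: formal_deriv_def lin_ext_forest_eval_shift a left_deriv_forest_eval)
qed (simp_all add: formal_deriv_def lin_ext_add lin_ext_scale left_deriv_linear)

lemma span_imp_lin_ext:
  assumes "x \<in> pm.span (h ` Z)"
  shows "\<exists>p. Poly_Mapping.keys p \<subseteq> Z \<and> lin_ext h p = x"
  using assms
proof (induction rule: pm.span_induct_alt)
  case base
  show ?case by (rule exI[of _ 0]) simp
next
  case (step c u v)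
  then obtain z p where "z \<in> Z" "u = h z" "Poly_Mapping.keys p \<subseteq> Z" "lin_ext h p = v" by blast
  then show ?case
    by (intro exI[of _ "pm_scale c (basis_vec z) + p"])
      (auto simp: lin_ext_add lin_ext_scale in_keys_iff lookup_add lookup_single when_def split: if_splits)
qed

text \<open>
  The derivation \<open>left_deriv b\<close> lifts to the polynomial ring in the trees. The lift is unique only by
  the algebraic independence that is to be proved, so for the largest possible upper entry it has to be
  chosen to be the monomial of the subtrees.
\<close>

lemma left_deriv_word_eval_coefficients:
  obtains a :: "nat \<times> 'd \<Rightarrow> 'd rtree \<Rightarrow> ('d rtree multiset \<Rightarrow>\<^sub>0 'k::field)"
  where "\<And>k d t G. G \<in> Poly_Mapping.keys (a (k, d) t) \<Longrightarrow> size G = k \<and> weight G = weight (children t)"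
    and "\<And>k d t. d \<noteq> label t \<or> size (children t) < k \<Longrightarrow> a (k, d) t = 0"
    and "\<And>t. a (size (children t), label t) t = basis_vec (children t)"
    and "\<And>b t. lin_ext forest_eval (a b t) = left_deriv b (word_eval t)"
proof -
  let ?P = "\<lambda>b t p. Poly_Mapping.keys p \<subseteq> {G. size G = fst b \<and> weight G = weight (children t)} \<and>
      (snd b \<noteq> label t \<or> size (children t) < fst b \<longrightarrow> p = 0) \<and>
      (b = (size (children t), label t) \<longrightarrow> p = basis_vec (children t)) \<and>
      lin_ext forest_eval p = (left_deriv b (word_eval t) :: (nat \<times> 'd) list \<Rightarrow>\<^sub>0 'k)"
  have "\<exists>p. ?P (k, d) t p" for k d t
  proof (cases "d \<noteq> label t \<or> size (children t) < k")
    case True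
    then show ?thesis
      by (intro exI[of _ 0]) (auto simp: left_deriv_word_eval(1))
  next
    case low: False
    show ?thesis
    proof (cases "k = size (children t)")
      case True
      then show ?thesis
        using low by (intro exI[of _ "basis_vec (children t)"]) (auto simp: left_deriv_word_eval(2))
    next
      case False
      with low span_imp_lin_ext[OF left_deriv_word_eval(3)[of k d t, unfolded forest_span_def]]
      show ?thesis by auto
    qed
  qed
  then have ex: "\<exists>p. ?P b t p" for b t by (cases b) simp
  define a where "a b t = (SOME p. ?P b t p)" for b t
  have a: "?P b t (a b t)" for b t
    unfolding a_def by (rule someI_ex[OF ex])
  show ?thesis
  proof (rule that[of a])
    show "size G = k \<and> weight G = weight (children t)" if "G \<in> Poly_Mapping.keys (a (k, d) t)" for k d t G
      using a[of "(k, d)" t] that by auto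
    show "a (k, d) t = 0" if "d \<noteq> label t \<or> size (children t) < k" for k d t
      using a[of "(k, d)" t] that by simp
    show "a (size (children t), label t) t = basis_vec (children t)" for t
      using a[of "(size (children t), label t)" t] by simp
    show "lin_ext forest_eval (a b t) = left_deriv b (word_eval t)" for b t
      using a[of b t] by simp
  qed
qed

text \<open>
  Induction on a bound for the number of vertices of the monomials: the formal derivatives of a relation
  are relations of smaller weight, hence zero, so the relation is a constant polynomial, and the empty
  word is not zero.
\<close>

lemma lin_ext_forest_eval_eq_0:
  fixes p :: "'d rtree multiset \<Rightarrow>\<^sub>0 'k::field_char_0"
  assumes "lin_ext forest_eval p = 0"
  shows "p = 0"
proof -
  obtain a :: "nat \<times> 'd \<Rightarrow> 'd rtree \<Rightarrow> ('d rtree multiset \<Rightarrow>\<^sub>0 'k)" where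
    homogeneous: "\<And>k d t G. G \<in> Poly_Mapping.keys (a (k, d) t) \<Longrightarrow> size G = k \<and> weight G = weight (children t)"
    and low: "\<And>k d t. d \<noteq> label t \<or> size (children t) < k \<Longrightarrow> a (k, d) t = 0"
    and top: "\<And>t. a (size (children t), label t) t = basis_vec (children t)"
    and deriv: "\<And>b t. lin_ext forest_eval (a b t) = left_deriv b (word_eval t)"
    by (rule left_deriv_word_eval_coefficients) blast
  have "q = 0" if "\<And>F. F \<in> Poly_Mapping.keys q \<Longrightarrow> weight F < n" "lin_ext forest_eval q = 0"
    for q :: "'d rtree multiset \<Rightarrow>\<^sub>0 'k" and n
    using that
  proof (induction n arbitrary: q)
    case 0
    then show ?case by (auto simp flip: keys_eq_empty)
  next
    case (Suc n)
    have "formal_deriv (a b) q = 0" for b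
    proof (rule Suc.IH)
      show "lin_ext forest_eval (formal_deriv (a b) q) = 0"
        by (simp add: lin_ext_forest_eval_formal_deriv[OF deriv] Suc.prems left_deriv_linear)
    next
      fix H assume "H \<in> Poly_Mapping.keys (formal_deriv (a b) q)"
      then obtain E t G where H: "add_mset t E \<in> Poly_Mapping.keys q"
        "G \<in> Poly_Mapping.keys (a b t)" "H = E + G"
        by (rule keys_formal_deriv)
      have "nodes t = Suc (weight (children t))" by (cases t) simp
      moreover have "weight G = weight (children t)"
        using H(2) homogeneous by (cases b) blast
      ultimately show "weight H < n" using Suc.prems(1)[OF H(1)] H(3) by simp
    qed
    then have keys: "Poly_Mapping.keys q \<subseteq> {{#}}"
      by (intro formal_deriv_kernel[where a = a, OF homogeneous low top])
    have "lin_ext forest_eval q = pm_scale (Poly_Mapping.lookup q {#}) (basis_vec [])"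
      using lin_ext_superset[OF _ keys, of forest_eval] by simp
    then have "Poly_Mapping.lookup (lin_ext forest_eval q) [] = Poly_Mapping.lookup q {#}"
      by simp
    then have "Poly_Mapping.lookup q {#} = 0" by (simp add: Suc.prems)
    with keys show ?case by (metis in_keys_iff keys_eq_empty subset_singletonD singletonI)
  qed
  moreover have "weight F < Suc (Max (weight ` Poly_Mapping.keys p))" if "F \<in> Poly_Mapping.keys p" for F
    using that by (simp add: le_imp_less_Suc)
  ultimately show ?thesis using assms by blast
qed

text \<open>
  The trees are the monomials of degree one.
\<close>

lemma lin_ext_word_eval_eq_0:
  fixes p :: "'d rtree \<Rightarrow>\<^sub>0 'k::field_char_0"
  assumes "lin_ext word_eval p = 0"
  shows "p = 0"
proof -
  let ?q = "lin_ext (\<lambda>t. basis_vec {#t#}) p"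
  have "lin_ext forest_eval (lin_ext (\<lambda>t. basis_vec {#t#}) p) = lin_ext word_eval p"
    for p :: "'d rtree \<Rightarrow>\<^sub>0 'k"
    by (induction p rule: pm_linear_induct) (simp_all add: lin_ext_add lin_ext_scale shuffle_prod_Nil)
  then have "?q = 0" using assms by (intro lin_ext_forest_eval_eq_0) simp
  moreover have "Poly_Mapping.lookup (lin_ext (\<lambda>t. basis_vec {#t#}) p) {#t#} = Poly_Mapping.lookup p t"
    for p :: "'d rtree \<Rightarrow>\<^sub>0 'k" and t
    by (induction p rule: pm_linear_induct)
      (simp_all add: lin_ext_add lin_ext_scale lookup_add lookup_single when_def)
  ultimately show ?thesis by (metis lookup_zero poly_mapping_eqI)
qed

lemma inj_lin_ext_imp_independent:
  fixes h :: "'a \<Rightarrow> ('b \<Rightarrow>\<^sub>0 'k::field)"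
  assumes inj: "\<And>p. lin_ext h p = 0 \<Longrightarrow> p = 0"
  shows "inj h" "pm.independent (range h)"
proof -
  show "inj h"
  proof (rule injI)
    fix s t assume "h s = h t"
    then have "lin_ext h (basis_vec s + pm_scale (- 1) (basis_vec t)) = 0"
      unfolding lin_ext_add lin_ext_scale by simp
    from inj[OF this] have "Poly_Mapping.lookup (basis_vec s + pm_scale (- 1) (basis_vec t)) s = (0 :: 'k)"
      by simp
    then show "s = t" by (auto simp: lookup_minus lookup_single when_def split: if_splits)
  qed
  show "pm.independent (range h)"
    unfolding pm.independent_explicit_module
  proof (intro allI impI)
    fix T u v
    assume T: "finite T" "T \<subseteq> range h" "(\<Sum>x\<in>T. pm_scale (u x) x) = 0" "v \<in> T"
    then obtain S where S: "finite S" "T = h ` S" by (meson finite_subset_image)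
    define p where "p = (\<Sum>s\<in>S. pm_scale (u (h s)) (basis_vec s))"
    have "lin_ext h p = (\<Sum>s\<in>S. pm_scale (u (h s)) (h s))"
      unfolding p_def using S(1) by (induction S) (simp_all add: lin_ext_add lin_ext_scale)
    also have "\<dots> = 0"
      using T(3) \<open>inj h\<close> by (simp add: S(2) sum.reindex inj_on_subset)
    finally have "p = 0" by (rule inj)
    obtain s where s: "s \<in> S" "v = h s" using T(4) S(2) by auto
    have "Poly_Mapping.lookup p s = (\<Sum>x\<in>S. if x = s then u (h x) else 0)"
      unfolding p_def lookup_sum by (intro sum.cong) (auto simp: lookup_single when_def)
    with \<open>p = 0\<close> s S(1) show "u v = 0" by simp
  qed
qed

section \<open>Generated subalgebras, homomorphisms and products\<close>

lemma pre_lie_subalgebra_generated: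
  assumes "right_pre_lie_algebra scale A mul" "X \<subseteq> A"
  shows "pre_lie_subalgebra scale A mul (pre_lie_generated scale A mul X)"
proof -
  interpret right_pre_lie_algebra scale A mul by fact
  have "pre_lie_subalgebra scale A mul A"
    by (auto simp: pre_lie_subalgebra_def subspace_carrier mul_closed)
  then have sub: "pre_lie_generated scale A mul X \<subseteq> A"
    unfolding pre_lie_generated_def by (intro hull_minimal assms)
  have "subspace (pre_lie_generated scale A mul X)"
    unfolding pre_lie_generated_def hull_def
    by (rule subspace_Inter) (auto simp: pre_lie_subalgebra_def)
  moreover have "mul x y \<in> pre_lie_generated scale A mul X"
    if "x \<in> pre_lie_generated scale A mul X" "y \<in> pre_lie_generated scale A mul X" for x y
    using that unfolding pre_lie_generated_def hull_def by (auto simp: pre_lie_subalgebra_def)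
  ultimately show ?thesis using sub by (simp add: pre_lie_subalgebra_def)
qed

lemma right_pre_lie_algebra_subalgebra:
  assumes "right_pre_lie_algebra scale A mul" "pre_lie_subalgebra scale A mul S"
  shows "right_pre_lie_algebra scale S mul"
proof -
  interpret right_pre_lie_algebra scale A mul by fact
  from assms(2) have S: "S \<subseteq> A" "subspace S" "\<And>x y. x \<in> S \<Longrightarrow> y \<in> S \<Longrightarrow> mul x y \<in> S"
    by (auto simp: pre_lie_subalgebra_def)
  show ?thesis
    using S(1) by unfold_locales
      (auto simp: S(2,3) mul_add_left mul_add_right mul_scale_left mul_scale_right
        subset_iff intro: right_pre_lie)
qed

text \<open>
  The elements on which the two homomorphisms agree form a subalgebra.
\<close>

lemma pre_lie_hom_unique:
  assumes A: "right_pre_lie_algebra scaleA A mulA" and L: "right_pre_lie_algebra scaleL L mulL"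
    and X: "X \<subseteq> A"
    and h: "pre_lie_hom scaleA (pre_lie_generated scaleA A mulA X) mulA scaleL L mulL h"
    and h': "pre_lie_hom scaleA (pre_lie_generated scaleA A mulA X) mulA scaleL L mulL h'"
    and eq: "\<And>x. x \<in> X \<Longrightarrow> h x = h' x"
    and y: "y \<in> pre_lie_generated scaleA A mulA X"
  shows "h y = h' y"
proof -
  interpret A: right_pre_lie_algebra scaleA A mulA by fact
  interpret L: right_pre_lie_algebra scaleL L mulL by fact
  let ?G = "pre_lie_generated scaleA A mulA X"
  have G: "?G \<subseteq> A" "A.subspace ?G" "\<And>x y. x \<in> ?G \<Longrightarrow> y \<in> ?G \<Longrightarrow> mulA x y \<in> ?G"
    using pre_lie_subalgebra_generated[OF A X] by (auto simp: pre_lie_subalgebra_def)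
  have XG: "X \<subseteq> ?G" unfolding pre_lie_generated_def by (rule hull_subset)
  have zero: "k 0 = 0" if "pre_lie_hom scaleA ?G mulA scaleL L mulL k" for k
  proof -
    have "0 \<in> ?G" by (rule A.subspace_0[OF G(2)])
    with that have "k (0 + 0) = k 0 + k 0" unfolding pre_lie_hom_def by blast
    then show ?thesis by simp
  qed
  have "?G \<subseteq> {x \<in> ?G. h x = h' x}"
    unfolding pre_lie_generated_def
  proof (rule hull_minimal)
    show "X \<subseteq> {x \<in> pre_lie_subalgebra scaleA A mulA hull X. h x = h' x}"
      using XG eq by (auto simp: pre_lie_generated_def)
    have "A.subspace {x \<in> ?G. h x = h' x}"
      using h h' G(2) zero[OF h] zero[OF h']
      by (auto simp: A.subspace_def pre_lie_hom_def)
    moreover have "mulA x y \<in> {x \<in> ?G. h x = h' x}"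
      if "x \<in> {x \<in> ?G. h x = h' x}" "y \<in> {x \<in> ?G. h x = h' x}" for x y
      using that h h' G(3) by (auto simp: pre_lie_hom_def)
    ultimately show "pre_lie_subalgebra scaleA A mulA
        {x \<in> pre_lie_subalgebra scaleA A mulA hull X. h x = h' x}"
      using G(1) unfolding pre_lie_subalgebra_def pre_lie_generated_def by auto
  qed
  with y show ?thesis by blast
qed

definition prod_scale :: "('k \<Rightarrow> 'a \<Rightarrow> 'a) \<Rightarrow> ('k \<Rightarrow> 'b \<Rightarrow> 'b) \<Rightarrow> 'k \<Rightarrow> 'a \<times> 'b \<Rightarrow> 'a \<times> 'b" where
  "prod_scale sA sB c = map_prod (sA c) (sB c)"

definition prod_mul :: "('a \<Rightarrow> 'a \<Rightarrow> 'a) \<Rightarrow> ('b \<Rightarrow> 'b \<Rightarrow> 'b) \<Rightarrow> 'a \<times> 'b \<Rightarrow> 'a \<times> 'b \<Rightarrow> 'a \<times> 'b" where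
  "prod_mul mA mB x y = (mA (fst x) (fst y), mB (snd x) (snd y))"

lemma right_pre_lie_algebra_prod:
  assumes "right_pre_lie_algebra sA A mA" "right_pre_lie_algebra sB B mB"
  shows "right_pre_lie_algebra (prod_scale sA sB) (A \<times> B) (prod_mul mA mB)"
proof -
  interpret A: right_pre_lie_algebra sA A mA by fact
  interpret B: right_pre_lie_algebra sB B mB by fact
  interpret P: vector_space "prod_scale sA sB"
    by unfold_locales (auto simp: prod_scale_def A.scale_right_distrib B.scale_right_distrib
        A.scale_left_distrib B.scale_left_distrib)
  show ?thesis
  proof unfold_locales
    show "P.subspace (A \<times> B)"
      using A.subspace_carrier B.subspace_carrier
      by (auto simp: P.subspace_def A.subspace_def B.subspace_def prod_scale_def zero_prod_def)
  qed (auto simp: prod_mul_def prod_scale_def A.mul_closed B.mul_closed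
      A.mul_add_left B.mul_add_left A.mul_add_right B.mul_add_right
      A.mul_scale_left B.mul_scale_left A.mul_scale_right B.mul_scale_right
      intro: A.right_pre_lie B.right_pre_lie)
qed

lemma fst_tree_eval_prod:
  "fst (tree_eval (prod_mul mA mB) g t) = tree_eval mA (\<lambda>d. fst (g d)) t"
proof (induction t)
  case (Node d C)
  have "fst (foldl (prod_mul mA mB) x ys) = foldl mA (fst x) (map fst ys)" for x ys
    by (induction ys arbitrary: x) (simp_all add: prod_mul_def)
  moreover have "map (\<lambda>s. fst (tree_eval (prod_mul mA mB) g s)) (enum_mset C) =
      map (tree_eval mA (\<lambda>d. fst (g d))) (enum_mset C)"
    using Node by (intro map_cong) simp_all
  ultimately show ?case by (simp only: tree_eval.simps map_map comp_def)
qed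

section \<open>The universal property\<close>

text \<open>
  The graph of the homomorphism is the subalgebra \<open>\<Gamma>\<close> of the product with \<open>L\<close> generated by the pairs
  \<open>(generator d, \<psi> d)\<close>, and \<open>G\<close> is its first projection. The labels range over the whole type; this
  covers maps defined on a set \<open>D\<close> of labels by extension with zero.
\<close>

lemma ex_pre_lie_hom_words:
  fixes \<psi> :: "'d \<Rightarrow> 'l::ab_group_add" and scaleL :: "'k::field_char_0 \<Rightarrow> 'l \<Rightarrow> 'l"
  assumes L: "right_pre_lie_algebra scaleL L mulL" and \<psi>: "\<And>d. \<psi> d \<in> L"
  obtains G h where "pre_lie_subalgebra pm_scale UNIV (bullet f_shift) G" "range generator \<subseteq> G"
    "pre_lie_hom (pm_scale :: 'k \<Rightarrow> _) G (bullet f_shift) scaleL L mulL h" "\<And>d. h (generator d) = \<psi> d"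
proof -
  interpret L: right_pre_lie_algebra scaleL L mulL by fact
  define scaleP where "scaleP = prod_scale (pm_scale :: 'k \<Rightarrow> ((nat \<times> 'd) list \<Rightarrow>\<^sub>0 'k) \<Rightarrow> _) scaleL"
  define mulP where "mulP = prod_mul (bullet (f_shift :: (nat \<times> 'd \<Rightarrow>\<^sub>0 'k) \<Rightarrow> _)) mulL"
  define P where "P = (UNIV :: ((nat \<times> 'd) list \<Rightarrow>\<^sub>0 'k) set) \<times> L"
  have P: "right_pre_lie_algebra scaleP P mulP"
    unfolding scaleP_def mulP_def P_def
    by (intro right_pre_lie_algebra_prod words.right_pre_lie_algebra_axioms L)
  interpret P: right_pre_lie_algebra scaleP P mulP by (rule P)
  define g where "g d = (generator d :: (nat \<times> 'd) list \<Rightarrow>\<^sub>0 'k, \<psi> d)" for d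
  have g: "g d \<in> P" for d by (simp add: g_def P_def \<psi>)
  define \<Gamma> where "\<Gamma> = pre_lie_generated scaleP P mulP (range g)"
  have \<Gamma>: "\<Gamma> \<subseteq> P" "P.subspace \<Gamma>" "\<And>x y. x \<in> \<Gamma> \<Longrightarrow> y \<in> \<Gamma> \<Longrightarrow> mulP x y \<in> \<Gamma>"
    using pre_lie_subalgebra_generated[OF P, of "range g"] g
    by (auto simp: pre_lie_subalgebra_def \<Gamma>_def)
  have g\<Gamma>: "g d \<in> \<Gamma>" for d
    unfolding \<Gamma>_def pre_lie_generated_def by (rule hull_inc) simp
  let ?N = "tree_eval mulP g"
  have fst_N: "fst (?N t) = word_eval t" for t
    unfolding mulP_def fst_tree_eval_prod by (simp add: g_def)
  have "inj_on fst (P.span (range ?N))"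
  proof -
    interpret fst: module_hom scaleP pm_scale fst
      by unfold_locales (auto simp: scaleP_def prod_scale_def)
    have range: "fst ` range ?N = range word_eval"
      by (simp add: image_image fst_N)
    have inj: "inj (word_eval :: 'd rtree \<Rightarrow> (nat \<times> 'd) list \<Rightarrow>\<^sub>0 'k)"
      and indep: "pm.independent (range (word_eval :: 'd rtree \<Rightarrow> (nat \<times> 'd) list \<Rightarrow>\<^sub>0 'k))"
      by (rule inj_lin_ext_imp_independent, erule lin_ext_word_eval_eq_0)+
    show ?thesis
    proof (rule fst.inj_on_span_independent_image)
      show "pm.independent (fst ` range ?N)" unfolding range by (rule indep)
      show "inj_on fst (range ?N)"
      proof (rule inj_onI)
        fix x y assume "x \<in> range ?N" "y \<in> range ?N" "fst x = fst y"
        then obtain s t where "x = ?N s" "y = ?N t" "word_eval s = (word_eval t :: (nat \<times> 'd) list \<Rightarrow>\<^sub>0 'k)"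
          by (metis fst_N rangeE)
        then show "x = y" by (auto dest: injD[OF inj])
      qed
    qed
  qed
  then have inj: "inj_on fst \<Gamma>"
    by (rule inj_on_subset) (unfold \<Gamma>_def, rule P.pre_lie_generated_subset_span[OF g])
  define G where "G = fst ` \<Gamma>"
  define h where "h x = snd (the_inv_into \<Gamma> fst x)" for x
  have h: "h (fst z) = snd z" if "z \<in> \<Gamma>" for z
    using that by (simp add: h_def the_inv_into_f_f[OF inj])
  have add: "x + y \<in> \<Gamma>" if "x \<in> \<Gamma>" "y \<in> \<Gamma>" for x y
    using that \<Gamma>(2) by (rule P.subspace_add[rotated 1])
  have scale: "scaleP c x \<in> \<Gamma>" if "x \<in> \<Gamma>" for c x
    using P.subspace_scale[OF \<Gamma>(2) that] .
  have zero: "0 \<in> \<Gamma>" by (rule P.subspace_0[OF \<Gamma>(2)])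
  show ?thesis
  proof (rule that[of G h])
    have "pm.subspace G"
      unfolding pm.subspace_def G_def
    proof (intro conjI ballI allI)
      show "0 \<in> fst ` \<Gamma>" using zero by (metis fst_zero image_eqI)
      fix x assume "x \<in> fst ` \<Gamma>"
      then obtain x' where x: "x = fst x'" "x' \<in> \<Gamma>" by auto
      show "pm_scale c x \<in> fst ` \<Gamma>" for c
        using scale[OF x(2), of c] by (rule rev_image_eqI) (simp add: x scaleP_def prod_scale_def)
      fix y assume "y \<in> fst ` \<Gamma>"
      then obtain y' where y: "y = fst y'" "y' \<in> \<Gamma>" by auto
      show "x + y \<in> fst ` \<Gamma>"
        using add[OF x(2) y(2)] by (rule rev_image_eqI) (simp add: x y)
    qed
    moreover have "bullet f_shift x y \<in> G" if "x \<in> G" "y \<in> G" for x y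
    proof -
      from that obtain x' y' where xy: "x = fst x'" "x' \<in> \<Gamma>" "y = fst y'" "y' \<in> \<Gamma>"
        by (auto simp: G_def)
      show ?thesis
        unfolding G_def using \<Gamma>(3)[OF xy(2,4)]
        by (rule rev_image_eqI) (simp add: xy mulP_def prod_mul_def)
    qed
    ultimately show "pre_lie_subalgebra pm_scale UNIV (bullet f_shift) G"
      by (simp add: pre_lie_subalgebra_def)
    show "range generator \<subseteq> G"
      unfolding G_def using g\<Gamma> by (force simp: g_def)
    show "h (generator d) = \<psi> d" for d
      using h[OF g\<Gamma>[of d]] by (simp add: g_def)
    have "h (fst x + fst y) = h (fst x) + h (fst y)" if "x \<in> \<Gamma>" "y \<in> \<Gamma>" for x y
      using h[OF add[OF that]] h that by simp
    moreover have "h (pm_scale c (fst x)) = scaleL c (h (fst x))" if "x \<in> \<Gamma>" for c x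
      using h[OF scale[OF that, of c]] h[OF that] by (simp add: scaleP_def prod_scale_def)
    moreover have "h (bullet f_shift (fst x) (fst y)) = mulL (h (fst x)) (h (fst y))"
      if "x \<in> \<Gamma>" "y \<in> \<Gamma>" for x y
      using h[OF \<Gamma>(3)[OF that]] h that by (simp add: mulP_def prod_mul_def)
    moreover have "h (fst x) \<in> L" if "x \<in> \<Gamma>" for x
      using h[OF that] \<Gamma>(1) that by (auto simp: P_def)
    ultimately show "pre_lie_hom pm_scale G (bullet f_shift) scaleL L mulL h"
      by (auto simp: pre_lie_hom_def G_def)
  qed
qed

text \<open>
  The subalgebra generated inside \<open>tensor_space (biletters D)\<close> is an intersection of the subalgebras of
  that space, which is meaningful because the space itself is one of them; the next lemmas prove this.
\<close>

lemma subspace_tensor_space: "pm.subspace (tensor_space X :: ('b list \<Rightarrow>\<^sub>0 'k::field) set)"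
  unfolding pm.subspace_def
proof (intro conjI ballI allI)
  show "0 \<in> tensor_space X" by (simp add: tensor_space_def)
next
  fix p q :: "'b list \<Rightarrow>\<^sub>0 'k"
  assume "p \<in> tensor_space X" "q \<in> tensor_space X"
  then show "p + q \<in> tensor_space X"
    using Poly_Mapping.keys_add[of p q] by (auto simp: tensor_space_def subset_iff)
next
  fix c and p :: "'b list \<Rightarrow>\<^sub>0 'k"
  assume "p \<in> tensor_space X"
  then show "pm_scale c p \<in> tensor_space X"
    by (simp add: tensor_space_def in_keys_iff)
qed

lemma lin_ext_tensor_space:
  assumes "p \<in> tensor_space X" "\<And>w. set w \<subseteq> X \<Longrightarrow> h w \<in> tensor_space Y"
  shows "lin_ext h p \<in> tensor_space Y"
  unfolding lin_ext_def
proof (intro pm.subspace_sum pm.subspace_scale subspace_tensor_space)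
  fix w assume "w \<in> Poly_Mapping.keys p"
  with assms(1) have "set w \<subseteq> X" by (auto simp: tensor_space_def)
  then show "h w \<in> tensor_space Y" by (rule assms(2))
qed

lemma bilin_ext_tensor_space:
  assumes "p \<in> tensor_space X" "q \<in> tensor_space X"
    and "\<And>u v. set u \<subseteq> X \<Longrightarrow> set v \<subseteq> X \<Longrightarrow> h u v \<in> tensor_space X"
  shows "bilin_ext h p q \<in> tensor_space X"
  unfolding bilin_ext_def by (intro lin_ext_tensor_space[where X = X] assms)

lemma prepend_basis_tensor_space:
  assumes "x \<in> X" "p \<in> tensor_space X"
  shows "prepend (basis_vec x) p \<in> tensor_space X"
proof -
  have "prepend (basis_vec x) p = lin_ext (\<lambda>w. basis_vec (x # w)) p"
    by (simp add: prepend_def bilin_ext_def)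
  also have "\<dots> \<in> tensor_space X"
    by (rule lin_ext_tensor_space[OF assms(2)]) (use assms(1) in \<open>auto simp: tensor_space_def\<close>)
  finally show ?thesis .
qed

lemma shuffle_words_tensor_space:
  "set u \<subseteq> X \<Longrightarrow> set v \<subseteq> X \<Longrightarrow> shuffle_words u v \<in> tensor_space X"
proof (induction u v rule: shuffle_words.induct)
  case (3 x u y v)
  then show ?case
    by (auto intro!: pm.subspace_add subspace_tensor_space prepend_basis_tensor_space)
qed (simp_all add: tensor_space_def)

lemma bullet_words_tensor_space:
  assumes "set u \<subseteq> biletters D" "set v \<subseteq> biletters D"
  shows "bullet_words f_shift u v \<in> tensor_space (biletters D)"
  using assms
proof (induction u)
  case Nil
  show ?case by (simp add: tensor_space_def)
next
  case (Cons x u)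
  obtain k d where x: "x = (k, d)" by (cases x)
  show ?case
    unfolding x bullet_words.simps f_shift_basis
    using Cons x
    by (intro pm.subspace_add subspace_tensor_space prepend_basis_tensor_space
        shuffle_words_tensor_space) auto
qed

lemma right_pre_lie_algebra_tensor_space:
  "right_pre_lie_algebra pm_scale (tensor_space (biletters D)) (bullet f_shift)"
proof (rule right_pre_lie_algebra_subalgebra[OF words.right_pre_lie_algebra_axioms])
  show "pre_lie_subalgebra pm_scale UNIV (bullet f_shift) (tensor_space (biletters D))"
    unfolding pre_lie_subalgebra_def bullet_def
    by (auto intro: subspace_tensor_space bilin_ext_tensor_space bullet_words_tensor_space)
qed

theorem corollary31:
  fixes D :: "'d set"
  shows "freely_generated_pre_lie TYPE('l::ab_group_add)
           (pm_scale :: 'k::field_char_0 \<Rightarrow> ((nat \<times> 'd) list \<Rightarrow>\<^sub>0 'k) \<Rightarrow> ((nat \<times> 'd) list \<Rightarrow>\<^sub>0 'k))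
           (g_alg D) (bullet f_shift) D generator"
proof -
  let ?T = "tensor_space (biletters D) :: ((nat \<times> 'd) list \<Rightarrow>\<^sub>0 'k) set"
  let ?g = "generator :: 'd \<Rightarrow> ((nat \<times> 'd) list \<Rightarrow>\<^sub>0 'k)"
  have T: "right_pre_lie_algebra pm_scale ?T (bullet f_shift)"
    by (rule right_pre_lie_algebra_tensor_space)
  have gT: "?g ` D \<subseteq> ?T" by (auto simp: generator_def tensor_space_def)
  have sub: "pre_lie_subalgebra pm_scale ?T (bullet f_shift) (g_alg D)"
    unfolding g_alg_def by (rule pre_lie_subalgebra_generated[OF T gT])
  have gen: "?g ` D \<subseteq> g_alg D"
    unfolding g_alg_def pre_lie_generated_def by (rule hull_subset)
  have universal: "\<exists>!h. h \<in> extensional (g_alg D) \<and>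
      pre_lie_hom pm_scale (g_alg D) (bullet f_shift) scaleL L mulL h \<and> (\<forall>d\<in>D. h (?g d) = \<phi> d)"
    if L: "right_pre_lie_algebra scaleL L mulL" and \<phi>: "\<phi> \<in> D \<rightarrow> L"
    for scaleL :: "'k \<Rightarrow> 'l \<Rightarrow> 'l" and L mulL \<phi>
  proof -
    interpret L: right_pre_lie_algebra scaleL L mulL by (rule L)
    define \<psi> where "\<psi> d = (if d \<in> D then \<phi> d else 0)" for d
    have \<psi>: "\<psi> d \<in> L" for d
      using \<phi> L.subspace_0[OF L.subspace_carrier] by (auto simp: \<psi>_def)
    obtain G h where G: "pre_lie_subalgebra pm_scale UNIV (bullet f_shift) G" "range ?g \<subseteq> G"
      and h: "pre_lie_hom pm_scale G (bullet f_shift) scaleL L mulL h" "\<And>d. h (?g d) = \<psi> d"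
      by (rule ex_pre_lie_hom_words[where \<psi> = \<psi>, OF L \<psi>]) blast
    have "g_alg D \<subseteq> ?T \<inter> G"
      unfolding g_alg_def pre_lie_generated_def
    proof (rule hull_minimal)
      show "?g ` D \<subseteq> ?T \<inter> G" using gT G(2) by auto
      show "pre_lie_subalgebra pm_scale ?T (bullet f_shift) (?T \<inter> G)"
        using G(1) subspace_tensor_space right_pre_lie_algebra.mul_closed[OF T]
        by (auto simp: pre_lie_subalgebra_def intro: pm.subspace_inter)
    qed
    then have in_G: "x \<in> G" if "x \<in> g_alg D" for x using that by blast
    have closed: "x + y \<in> g_alg D" "pm_scale c x \<in> g_alg D" "bullet f_shift x y \<in> g_alg D"
      if "x \<in> g_alg D" "y \<in> g_alg D" for x y :: "(nat \<times> 'd) list \<Rightarrow>\<^sub>0 'k" and c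
      using sub that by (simp_all add: pre_lie_subalgebra_def pm.subspace_add pm.subspace_scale)
    have hom: "pre_lie_hom pm_scale (g_alg D) (bullet f_shift) scaleL L mulL (restrict h (g_alg D))"
      using h(1) by (simp add: pre_lie_hom_def Pi_iff closed in_G)
    show ?thesis
    proof (rule ex1I[of _ "restrict h (g_alg D)"])
      show "restrict h (g_alg D) \<in> extensional (g_alg D) \<and>
          pre_lie_hom pm_scale (g_alg D) (bullet f_shift) scaleL L mulL (restrict h (g_alg D)) \<and>
          (\<forall>d\<in>D. restrict h (g_alg D) (?g d) = \<phi> d)"
      proof (intro conjI ballI restrict_extensional hom)
        fix d assume "d \<in> D"
        with gen have "?g d \<in> g_alg D" by blast
        with \<open>d \<in> D\<close> show "restrict h (g_alg D) (?g d) = \<phi> d" by (simp add: h(2) \<psi>_def)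
      qed
    next
      fix h'
      assume h': "h' \<in> extensional (g_alg D) \<and>
          pre_lie_hom pm_scale (g_alg D) (bullet f_shift) scaleL L mulL h' \<and>
          (\<forall>d\<in>D. h' (?g d) = \<phi> d)"
      show "h' = restrict h (g_alg D)"
      proof (rule extensionalityI[of _ "g_alg D"])
        fix y :: "(nat \<times> 'd) list \<Rightarrow>\<^sub>0 'k"
        assume y: "y \<in> g_alg D"
        show "h' y = restrict h (g_alg D) y"
        proof (rule pre_lie_hom_unique[OF T L gT, folded g_alg_def, OF _ hom _ y])
          show "pre_lie_hom pm_scale (g_alg D) (bullet f_shift) scaleL L mulL h'"
            using h' by blast
        next
          fix x assume "x \<in> ?g ` D"
          then obtain d where "x = ?g d" "d \<in> D" by blast
          moreover from this gen have "?g d \<in> g_alg D" by blast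
          ultimately show "h' x = restrict h (g_alg D) x"
            using h' by (simp add: h(2) \<psi>_def)
        qed
      qed (simp_all add: h')
    qed
  qed
  show ?thesis
    unfolding freely_generated_pre_lie_def
  proof (intro conjI allI impI)
    show "right_pre_lie_algebra pm_scale (g_alg D :: ((nat \<times> 'd) list \<Rightarrow>\<^sub>0 'k) set) (bullet f_shift)"
      by (rule right_pre_lie_algebra_subalgebra[OF T sub])
    show "?g \<in> D \<rightarrow> g_alg D" using gen by auto
  qed (elim conjE, rule universal)
qed

end
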